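(* Let $G$ and $H$ be profinite groups with $G \equiv H$. If one of them is strongly complete, then $G \cong H$.
   Context: A profinite group is called strongly complete if every subgroup of finite index is open. $G \equiv H$ (elementary equivalence) means that $G$ and $H$, regarded as abstract groups, satisfy the same first-order sentences in the language of groups. $G \cong H$ means isomorphic as profinite groups (i.e. via a group isomorphism that is a homeomorphism). *)

theory Defs
  imports "HOL-Algebra.Coset" "HOL-Analysis.T1_Spaces"
begin

section \<open>Profinite groups\<close>

definition topological_group :: "('a, 'm) monoid_scheme \<Rightarrow> 'a topology \<Rightarrow> bool" where
  "topological_group G T \<longleftrightarrow>
     group G \<and> topspace T = carrier G \<and>
     continuous_map (prod_topology T T) T (\<lambda>(x, y). x \<otimes>\<^bsub>G\<^esub> y) \<and>
     continuous_map T T (\<lambda>x. inv\<^bsub>G\<^esub> x)"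

definition totally_disconnected_space :: "'a topology \<Rightarrow> bool" where
  "totally_disconnected_space T \<longleftrightarrow> (\<forall>C. connectedin T C \<longrightarrow> (\<exists>a. C \<subseteq> {a}))"

definition profinite_group :: "('a, 'm) monoid_scheme \<Rightarrow> 'a topology \<Rightarrow> bool" where
  "profinite_group G T \<longleftrightarrow>
     topological_group G T \<and> compact_space T \<and> Hausdorff_space T \<and>
     totally_disconnected_space T"

definition strongly_complete :: "('a, 'm) monoid_scheme \<Rightarrow> 'a topology \<Rightarrow> bool" where
  "strongly_complete G T \<longleftrightarrow>
     (\<forall>K. subgroup K G \<and> finite (rcosets\<^bsub>G\<^esub> K) \<longrightarrow> openin T K)"

definition profinite_isomorphic ::
  "('a, 'm) monoid_scheme \<Rightarrow> 'a topology \<Rightarrow> ('b, 'n) monoid_scheme \<Rightarrow> 'b topology \<Rightarrow> bool" where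
  "profinite_isomorphic G T H S \<longleftrightarrow> (\<exists>f. f \<in> iso G H \<and> homeomorphic_map T S f)"

section \<open>First-order logic in the language of groups\<close>

text \<open>Variables are named by natural numbers; the remaining connectives and the existential
  quantifier are definable from negation, conjunction and the universal quantifier.\<close>

datatype group_term =
    Var nat
  | One
  | Inv group_term
  | Mult group_term group_term

datatype group_formula =
    Eq group_term group_term
  | Neg group_formula
  | Conj group_formula group_formula
  | All nat group_formula

primrec term_vars :: "group_term \<Rightarrow> nat set" where
  "term_vars (Var n) = {n}"
| "term_vars One = {}"
| "term_vars (Inv t) = term_vars t"
| "term_vars (Mult s t) = term_vars s \<union> term_vars t"

primrec free_vars :: "group_formula \<Rightarrow> nat set" where
  "free_vars (Eq s t) = term_vars s \<union> term_vars t"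
| "free_vars (Neg \<phi>) = free_vars \<phi>"
| "free_vars (Conj \<phi> \<psi>) = free_vars \<phi> \<union> free_vars \<psi>"
| "free_vars (All n \<phi>) = free_vars \<phi> - {n}"

definition sentence :: "group_formula \<Rightarrow> bool" where
  "sentence \<phi> \<longleftrightarrow> free_vars \<phi> = {}"

primrec term_value :: "('a, 'm) monoid_scheme \<Rightarrow> (nat \<Rightarrow> 'a) \<Rightarrow> group_term \<Rightarrow> 'a" where
  "term_value G e (Var n) = e n"
| "term_value G e One = \<one>\<^bsub>G\<^esub>"
| "term_value G e (Inv t) = inv\<^bsub>G\<^esub> (term_value G e t)"
| "term_value G e (Mult s t) = term_value G e s \<otimes>\<^bsub>G\<^esub> term_value G e t"

primrec holds :: "('a, 'm) monoid_scheme \<Rightarrow> (nat \<Rightarrow> 'a) \<Rightarrow> group_formula \<Rightarrow> bool" where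
  "holds G e (Eq s t) \<longleftrightarrow> term_value G e s = term_value G e t"
| "holds G e (Neg \<phi>) \<longleftrightarrow> \<not> holds G e \<phi>"
| "holds G e (Conj \<phi> \<psi>) \<longleftrightarrow> holds G e \<phi> \<and> holds G e \<psi>"
| "holds G e (All n \<phi>) \<longleftrightarrow> (\<forall>x \<in> carrier G. holds G (e(n := x)) \<phi>)"

text \<open>For a sentence the choice of the assignment into the (nonempty) carrier is irrelevant.\<close>

definition satisfies :: "('a, 'm) monoid_scheme \<Rightarrow> group_formula \<Rightarrow> bool" where
  "satisfies G \<phi> \<longleftrightarrow> (\<forall>e. range e \<subseteq> carrier G \<longrightarrow> holds G e \<phi>)"

definition elementarily_equivalent ::
  "('a, 'm) monoid_scheme \<Rightarrow> ('b, 'n) monoid_scheme \<Rightarrow> bool" where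
  "elementarily_equivalent G H \<longleftrightarrow>
     (\<forall>\<phi>. sentence \<phi> \<longrightarrow> (satisfies G \<phi> \<longleftrightarrow> satisfies H \<phi>))"

end

theory Submission
  imports Defs "HOL-Analysis.Urysohn" "HOL-Algebra.Product_Groups"
begin

text \<open>Write \<open>G\<^sub>F\<close> for the intersection of the kernels of all abstract homomorphisms from \<open>G\<close> to a
  finite group \<open>F\<close>. The homomorphisms of a profinite group into finite groups separate its points
  and determine its topology. Hence it suffices to identify the finite groups \<open>G / G\<^sub>F\<close> and
  \<open>H / H\<^sub>F\<close> for every \<open>F\<close>, to know that \<open>G\<^sub>F\<close> and \<open>H\<^sub>F\<close> are open, and to choose the
  identifications compatibly. By symmetry \<open>G\<close> may be taken to be strongly complete.

  Then every homomorphism from \<open>G\<close> to \<open>F\<close> is continuous, and \<open>G\<^sub>F\<close> is open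
  (\<open>openin_hom_class\<close>): the homomorphisms form a compact space, and if no finite set of them cut
  out \<open>G\<^sub>F\<close>, a cluster point of a suitable sequence of them would be discontinuous.

  The key point is that \<open>G\<^sub>F\<close> is defined, without parameters, by the solvability of a finite system
  of equations. By compactness of the power \<open>F\<^sup>G\<close>, an element \<open>x\<close> is killed by all homomorphisms
  into \<open>F\<close> only if some finite part of the multiplication table of \<open>G\<close> forces this
  (\<open>killed_imp_in_solution_set\<close>): some tuple beginning with \<open>x\<close> satisfies relations of the form
  \<open>y\<^sub>i y\<^sub>j = y\<^sub>k\<close> all of whose solutions in \<open>F\<close> begin with the unit. There are only countably many such
  systems, and in a compact group the set defined by each of them is closed, so the Baire category
  theorem, followed by finitely many translations, yields one system that defines the whole of
  \<open>G\<^sub>F\<close> (\<open>hom_class_one_eq_solution_set\<close>).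

  That the set \<open>K\<close> defined by this system has finitely many cosets, with the multiplication table
  of \<open>G / G\<^sub>F\<close>, is a first-order property, so it holds in \<open>H\<close> as well. There \<open>K\<close> is closed because
  \<open>H\<close> is compact, thus open because its index is finite, and it lies in \<open>H\<^sub>F\<close> because homomorphisms
  preserve equations. So all homomorphisms from \<open>H\<close> to \<open>F\<close> are continuous and factor through
  \<open>H / K\<close>, a copy of \<open>G / G\<^sub>F\<close>. Choosing coset representatives gives maps \<open>f : G \<rightarrow> H\<close> and
  \<open>h : H \<rightarrow> G\<close> that homomorphisms into \<open>F\<close> cannot distinguish from mutually inverse isomorphisms
  (\<open>elementarily_equivalent_finite_quotients\<close>).

  For a fixed \<open>F\<close>, the pairs \<open>(f, h)\<close> with this property form a closed subset of the compact space
  \<open>H\<^sup>G \<times> G\<^sup>H\<close>. Finitely many of these subsets have a common element, since a finite family of finite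
  groups embeds in its product. A point in all of them is a pair of mutually inverse continuous
  isomorphisms.\<close>

section \<open>Compact topological groups\<close>

lemma compact_space_fip_family:
  assumes "compact_space X"
    and closed: "\<And>i. i \<in> I \<Longrightarrow> closedin X (C i)"
    and fip: "\<And>J. finite J \<Longrightarrow> J \<subseteq> I \<Longrightarrow> \<exists>x\<in>topspace X. \<forall>i\<in>J. x \<in> C i"
  shows "\<exists>x\<in>topspace X. \<forall>i\<in>I. x \<in> C i"
proof -
  let ?U = "insert (topspace X) (C ` I)"
  have *: "\<Inter>\<F> \<noteq> {}" if \<F>: "finite \<F>" "\<F> \<subseteq> ?U" for \<F>
  proof -
    have "finite (\<F> - {topspace X})" using \<F>(1) by simp
    moreover have "\<F> - {topspace X} \<subseteq> C ` I"
      using \<F>(2) by blast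
    ultimately have "\<exists>J\<subseteq>I. finite J \<and> \<F> - {topspace X} = C ` J"
      by (rule finite_subset_image)
    then obtain J where J: "J \<subseteq> I" "finite J" "\<F> - {topspace X} = C ` J"
      by (elim exE conjE)
    obtain x where x: "x \<in> topspace X" "\<forall>i\<in>J. x \<in> C i"
      using fip[OF J(2,1)] by (elim bexE)
    have "x \<in> D" if "D \<in> \<F>" for D
    proof (cases "D = topspace X")
      case False
      then have "D \<in> C ` J" using that unfolding J(3)[symmetric] by simp
      then show ?thesis using x(2) by auto
    qed (use x in simp)
    then show ?thesis by auto
  qed
  have "\<forall>D\<in>?U. closedin X D"
    using closed by simp
  moreover note iffD1[OF compact_space_fip assms(1), THEN spec, of ?U]
  ultimately have "\<Inter>?U \<noteq> {}"
    using * by simp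
  then obtain x where "x \<in> \<Inter>?U"
    unfolding ex_in_conv[symmetric] ..
  then show ?thesis by simp blast
qed

lemma finite_open_partition:
  assumes X: "compact_space X" and cover: "\<Union>\<U> = topspace X"
    and opn: "\<And>U. U \<in> \<U> \<Longrightarrow> openin X U" and disj: "pairwise disjnt \<U>"
    and ne: "\<And>U. U \<in> \<U> \<Longrightarrow> U \<noteq> {}"
  shows "finite \<U>"
proof -
  have "\<exists>\<F>. finite \<F> \<and> \<F> \<subseteq> \<U> \<and> \<Union>\<F> = topspace X"
    using iffD1[OF compact_space X, THEN spec, of \<U>] cover opn by simp
  then obtain \<F> where \<F>: "finite \<F>" "\<F> \<subseteq> \<U>" "\<Union>\<F> = topspace X"
    by (elim exE conjE)
  have "U \<in> \<F>" if U: "U \<in> \<U>" for U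
  proof -
    obtain x where x: "x \<in> U"
      using ne[OF U] by auto
    then have "x \<in> topspace X"
      using openin_subset[OF opn[OF U]] by auto
    then obtain V where V: "V \<in> \<F>" "x \<in> V"
      unfolding \<F>(3)[symmetric] by auto
    then have "V \<in> \<U>"
      using \<F>(2) by (rule_tac subsetD)
    then have "U = V"
      using disj U x V(2) by (auto simp: pairwise_def disjnt_iff)
    then show ?thesis
      using V(1) by simp
  qed
  then show ?thesis
    by (intro finite_subset[OF subsetI \<F>(1)])
qed

text \<open>Statements about the classes of the relation ``no homomorphism into \<open>F\<close> separates \<open>x\<close> from
  \<open>d\<close>'' thereby reduce to statements about a common kernel.\<close>

lemma hom_eq_iff_quotient:
  assumes "group G" "group F" "\<phi> \<in> hom G F" "x \<in> carrier G" "d \<in> carrier G"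
  shows "\<phi> (inv\<^bsub>G\<^esub> d \<otimes>\<^bsub>G\<^esub> x) = \<one>\<^bsub>F\<^esub> \<longleftrightarrow> \<phi> x = \<phi> d"
proof -
  interpret G: group G by fact
  interpret F: group F by fact
  have c: "\<phi> x \<in> carrier F" "\<phi> d \<in> carrier F"
    using assms by (auto simp: hom_in_carrier)
  have "\<phi> (inv\<^bsub>G\<^esub> d) = inv\<^bsub>F\<^esub> \<phi> d"
    using group_hom.hom_inv[of G F \<phi> d] assms by (simp add: group_hom_def group_hom_axioms_def)
  then have "\<phi> (inv\<^bsub>G\<^esub> d \<otimes>\<^bsub>G\<^esub> x) = inv\<^bsub>F\<^esub> \<phi> d \<otimes>\<^bsub>F\<^esub> \<phi> x"
    using hom_mult[OF assms(3), of "inv\<^bsub>G\<^esub> d" x] assms by simp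
  then show ?thesis
    using c by (metis F.inv_solve_left F.one_closed F.r_one)
qed

locale top_group = group G for G (structure) +
  fixes T
  assumes topological_group: "topological_group G T"
begin

lemma topspace_eq [simp]: "topspace T = carrier G"
  using topological_group by (simp add: topological_group_def)

lemma continuous_map_mult:
  assumes "continuous_map X T f" "continuous_map X T g"
  shows "continuous_map X T (\<lambda>x. f x \<otimes> g x)"
proof -
  have "continuous_map (prod_topology T T) T (\<lambda>(x, y). x \<otimes> y)"
    using topological_group by (simp add: topological_group_def)
  from continuous_map_compose[OF continuous_map_pairedI[OF assms] this]
  show ?thesis by (simp add: o_def)
qed

lemma continuous_map_translate:
  assumes "a \<in> carrier G"
  shows "continuous_map T T (\<lambda>x. a \<otimes> x)"
  using continuous_map_mult[of T "\<lambda>x. a" "\<lambda>x. x"] assms by simp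

lemma openin_hom_fibre:
  assumes "group F" and \<phi>: "\<phi> \<in> hom G F" and K: "openin T (kernel G F \<phi>)"
  shows "openin T {x \<in> carrier G. \<phi> x = c}"
proof (cases "\<exists>a\<in>carrier G. \<phi> a = c")
  case True
  then obtain a where a: "a \<in> carrier G" "\<phi> a = c" by blast
  have "\<phi> (inv a \<otimes> x) = \<one>\<^bsub>F\<^esub> \<longleftrightarrow> \<phi> x = c" if "x \<in> carrier G" for x
    using hom_eq_iff_quotient[OF is_group assms(1) \<phi> that a(1)] a(2) by simp
  then have "{x \<in> carrier G. \<phi> x = c} = {x \<in> topspace T. inv a \<otimes> x \<in> kernel G F \<phi>}"
    using a by (auto simp: kernel_def)
  then show ?thesis
    using openin_continuous_map_preimage[OF continuous_map_translate[of "inv a"] K] a by simp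
next
  case False
  then have "{x \<in> carrier G. \<phi> x = c} = {}" by blast
  then show ?thesis by (simp only: openin_empty)
qed

end

locale compact_group = top_group +
  assumes compact: "compact_space T" and Hausdorff: "Hausdorff_space T"
begin

lemma closedin_equalizer:
  "continuous_map X T f \<Longrightarrow> continuous_map X T g \<Longrightarrow> closedin X {x \<in> topspace X. f x = g x}"
  by (rule closedin_continuous_maps_eq[OF Hausdorff])

lemma finite_rcosets_open_subgroup:
  assumes K: "subgroup K G" and "openin T K"
  shows "finite (rcosets K)"
proof -
  have "openin T U" if U: "U \<in> rcosets K" for U
  proof -
    obtain a where a: "a \<in> carrier G" "U = K #> a"
      using U by (auto simp: RCOSETS_def)
    have "U = {x \<in> topspace T. x \<otimes> inv a \<in> K}"
    proof (intro equalityI subsetI)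
      fix x assume "x \<in> U"
      then obtain k where "k \<in> K" "x = k \<otimes> a"
        using a by (auto simp: r_coset_def)
      then show "x \<in> {x \<in> topspace T. x \<otimes> inv a \<in> K}"
        using a subgroup.mem_carrier[OF K] by (simp add: m_assoc)
    next
      fix x assume x: "x \<in> {x \<in> topspace T. x \<otimes> inv a \<in> K}"
      then have "x = (x \<otimes> inv a) \<otimes> a"
        using a by (simp add: m_assoc)
      then show "x \<in> U"
        using a x by (auto simp: r_coset_def)
    qed
    then show ?thesis
      using openin_continuous_map_preimage[OF continuous_map_mult[of T "\<lambda>x. x" "\<lambda>x. inv a"] assms(2)] a
      by simp
  qed
  moreover have "U \<noteq> {}" if U: "U \<in> rcosets K" for U
    using U rcos_self[OF _ K] by (auto simp: RCOSETS_def)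
  ultimately show ?thesis
    using rcosets_part_G[OF K] rcos_disjoint[OF K]
    by (intro finite_open_partition[OF compact]) auto
qed

text \<open>The witness is the set of all \<open>g\<close> that can be inserted between any two factors without
  changing membership of the product in \<open>V\<close>. This syntactic congruence class of the unit is a normal
  subgroup by its very form, and it is open because the other two factors range over a compact
  space.\<close>

lemma open_normal_inside_clopen:
  assumes V: "openin T V" "closedin T V" "\<one> \<in> V"
  shows "\<exists>N. N \<lhd> G \<and> openin T N \<and> N \<subseteq> V"
proof -
  define N where "N = {g \<in> carrier G. \<forall>x\<in>carrier G. \<forall>y\<in>carrier G. x \<otimes> g \<otimes> y \<in> V \<longleftrightarrow> x \<otimes> y \<in> V}"
  have sub: "subgroup N G"
  proof
    show "N \<subseteq> carrier G" "\<one> \<in> N"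
      by (auto simp: N_def)
    show "g \<otimes> h \<in> N" if gh: "g \<in> N" "h \<in> N" for g h
    proof -
      have c: "g \<in> carrier G" "h \<in> carrier G" using gh by (auto simp: N_def)
      have "x \<otimes> (g \<otimes> h) \<otimes> y \<in> V \<longleftrightarrow> x \<otimes> y \<in> V" if xy: "x \<in> carrier G" "y \<in> carrier G" for x y
      proof -
        have "x \<otimes> (g \<otimes> h) \<otimes> y = (x \<otimes> g) \<otimes> h \<otimes> y"
          using xy c by (simp add: m_assoc)
        also have "\<dots> \<in> V \<longleftrightarrow> x \<otimes> g \<otimes> y \<in> V"
          using gh(2) c xy by (auto simp: N_def)
        also have "\<dots> \<longleftrightarrow> x \<otimes> y \<in> V"
          using gh(1) xy by (auto simp: N_def)
        finally show ?thesis .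
      qed
      then show ?thesis using c by (simp add: N_def)
    qed
    show "inv g \<in> N" if g: "g \<in> N" for g
    proof -
      have c: "g \<in> carrier G" using g by (auto simp: N_def)
      have "x \<otimes> inv g \<otimes> y \<in> V \<longleftrightarrow> x \<otimes> y \<in> V" if xy: "x \<in> carrier G" "y \<in> carrier G" for x y
      proof -
        have "(x \<otimes> inv g) \<otimes> g \<otimes> y \<in> V \<longleftrightarrow> (x \<otimes> inv g) \<otimes> y \<in> V"
          using g c xy by (auto simp: N_def)
        then show ?thesis
          using c xy by (simp add: m_assoc)
      qed
      then show ?thesis using c by (simp add: N_def)
    qed
  qed
  have "N \<lhd> G"
  proof (subst normal_inv_iff, intro conjI sub ballI)
    fix z g assume z: "z \<in> carrier G" and g: "g \<in> N"
    have c: "g \<in> carrier G" using g by (auto simp: N_def)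
    have "x \<otimes> (z \<otimes> g \<otimes> inv z) \<otimes> y \<in> V \<longleftrightarrow> x \<otimes> y \<in> V" if xy: "x \<in> carrier G" "y \<in> carrier G" for x y
    proof -
      have "x \<otimes> (z \<otimes> g \<otimes> inv z) \<otimes> y = (x \<otimes> z) \<otimes> g \<otimes> (inv z \<otimes> y)"
        using xy c z by (simp add: m_assoc)
      also have "\<dots> \<in> V \<longleftrightarrow> (x \<otimes> z) \<otimes> (inv z \<otimes> y) \<in> V"
        using g xy z by (auto simp: N_def)
      also have "(x \<otimes> z) \<otimes> (inv z \<otimes> y) = x \<otimes> y"
        using xy z by (simp add: m_assoc[symmetric]) (simp add: m_assoc)
      finally show ?thesis .
    qed
    then show "z \<otimes> g \<otimes> inv z \<in> N" using c z by (simp add: N_def)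
  qed
  moreover have "N \<subseteq> V"
  proof
    fix g assume "g \<in> N"
    then have "g \<in> carrier G" "\<one> \<otimes> g \<otimes> \<one> \<in> V \<longleftrightarrow> \<one> \<otimes> \<one> \<in> V"
      unfolding N_def by blast+
    then show "g \<in> V" using V(3) by simp
  qed
  moreover have "openin T N"
  proof -
    \<comment> \<open>The complement of \<open>N\<close> is the projection along the compact space of pairs \<open>(x, y)\<close> of the
      closed set of all \<open>(g, (x, y))\<close> where the defining equivalence fails.\<close>
    let ?P = "prod_topology T (prod_topology T T)"
    let ?a = "\<lambda>p. fst (snd p) \<otimes> fst p \<otimes> snd (snd p)" and ?b = "\<lambda>p. fst (snd p) \<otimes> snd (snd p)"
    have proj: "continuous_map ?P T (\<lambda>p. fst p)" "continuous_map ?P T (\<lambda>p. fst (snd p))"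
      "continuous_map ?P T (\<lambda>p. snd (snd p))"
      using continuous_map_fst continuous_map_compose[OF continuous_map_snd continuous_map_fst]
        continuous_map_compose[OF continuous_map_snd continuous_map_snd]
      by (simp_all add: o_def)
    have a: "continuous_map ?P T ?a" and b: "continuous_map ?P T ?b"
      by (intro continuous_map_mult proj)+
    define bad where "bad = {p \<in> topspace ?P. ?a p \<in> V} \<inter> {p \<in> topspace ?P. ?b p \<in> topspace T - V}
       \<union> {p \<in> topspace ?P. ?a p \<in> topspace T - V} \<inter> {p \<in> topspace ?P. ?b p \<in> V}"
    have "closedin ?P bad"
      unfolding bad_def
      by (intro closedin_Un closedin_Int closedin_continuous_map_preimage[OF a]
          closedin_continuous_map_preimage[OF b] V closedin_diff closedin_topspace)
    moreover have "closed_map ?P T fst"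
      using compact by (intro closed_map_fst) (simp add: compact_space_prod_topology)
    ultimately have "closedin T (fst ` bad)"
      unfolding closed_map_def by blast
    moreover have "N = topspace T - fst ` bad"
    proof (intro equalityI subsetI)
      fix g assume "g \<in> N"
      then show "g \<in> topspace T - fst ` bad"
        by (auto simp: N_def bad_def)
    next
      fix g assume g: "g \<in> topspace T - fst ` bad"
      have "x \<otimes> g \<otimes> y \<in> V \<longleftrightarrow> x \<otimes> y \<in> V" if xy: "x \<in> carrier G" "y \<in> carrier G" for x y
      proof -
        have "(g, (x, y)) \<notin> bad"
          using g imageI[of "(g, (x, y))" bad fst] by auto
        then show ?thesis using g xy by (auto simp: bad_def)
      qed
      then show "g \<in> N" using g by (simp add: N_def)
    qed
    ultimately show ?thesis
      using openin_diff[OF openin_topspace] by metis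
  qed
  ultimately show ?thesis by blast
qed

end

lemma profinite_groupD:
  assumes "profinite_group G T"
  shows "compact_group G T"
  using assms
  by (simp add: profinite_group_def compact_group_def compact_group_axioms_def top_group_def
      top_group_axioms_def topological_group_def)

text \<open>In a compact Hausdorff space the component of \<open>x\<close> is the intersection of its clopen
  neighbourhoods. For a totally disconnected space this intersection is a single point, and by
  compactness finitely many clopen neighbourhoods already intersect inside \<open>U\<close>.\<close>

lemma profinite_clopen_base:
  assumes "profinite_group G T" and U: "openin T U" "x \<in> U"
  shows "\<exists>V. openin T V \<and> closedin T V \<and> x \<in> V \<and> V \<subseteq> U"
proof (rule ccontr)
  assume no: "\<not> ?thesis"
  have cpt: "compact_space T" and Hd: "Hausdorff_space T" and td: "totally_disconnected_space T"
    using assms(1) by (auto simp: profinite_group_def)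
  have xT: "x \<in> topspace T" using U openin_subset by blast
  let ?I = "{V. openin T V \<and> closedin T V \<and> x \<in> V}"
  have "\<exists>y\<in>topspace T. \<forall>V\<in>?I. y \<in> (topspace T - U) \<inter> V"
  proof (rule compact_space_fip_family[OF cpt])
    show "closedin T ((topspace T - U) \<inter> V)" if "V \<in> ?I" for V
      using that U by (auto intro: closedin_Int)
    fix J assume J: "finite J" "J \<subseteq> ?I"
    have "openin T (topspace T \<inter> \<Inter>J)" "closedin T (topspace T \<inter> \<Inter>J)" "x \<in> topspace T \<inter> \<Inter>J"
      using J xT by (auto intro!: openin_Int_Inter closedin_Inter[of "insert (topspace T) J" T, simplified])
    then have "\<not> topspace T \<inter> \<Inter>J \<subseteq> U"
      using no by blast
    then show "\<exists>y\<in>topspace T. \<forall>V\<in>J. y \<in> (topspace T - U) \<inter> V"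
      by blast
  qed
  then obtain y where y: "y \<in> topspace T" "\<And>V. V \<in> ?I \<Longrightarrow> y \<in> (topspace T - U) \<inter> V" by blast
  then have "quasi_component_of T x y"
    using xT by (auto simp: quasi_component_of)
  then have "connected_component_of T x y"
    using quasi_eq_connected_component_of[of T x] cpt Hd by simp
  then obtain C where C: "connectedin T C" "x \<in> C" "y \<in> C"
    by (auto simp: connected_component_of_def)
  then have "x = y"
    using td unfolding totally_disconnected_space_def by blast
  moreover have "y \<notin> U"
    using y(2)[of "topspace T"] xT by auto
  ultimately show False using U by blast
qed

section \<open>Common kernels of homomorphisms into a finite group\<close>

text \<open>For \<open>d\<close> in the carrier this is the coset of \<open>d\<close> modulo the common kernel of all homomorphisms
  into \<open>F\<close>; in particular the class of the unit is the common kernel.\<close>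

definition hom_class ::
    "('a, 'm) monoid_scheme \<Rightarrow> ('c, 'k) monoid_scheme \<Rightarrow> 'a \<Rightarrow> 'a set" where
  "hom_class G F d = {x \<in> carrier G. \<forall>\<phi>\<in>hom G F. \<phi> x = \<phi> d}"

text \<open>Conditions on a function that only involve finitely many of its values are clopen in a power of
  a discrete space. This and its closed counterpart are the form in which compactness of a power
  of a finite group is used.\<close>

lemma openin_finitely_determined:
  assumes B: "finite B" "B \<subseteq> I"
    and det: "\<And>f g. f \<in> topspace (product_topology (\<lambda>_. discrete_topology A) I) \<Longrightarrow>
      g \<in> topspace (product_topology (\<lambda>_. discrete_topology A) I) \<Longrightarrow>
      (\<And>b. b \<in> B \<Longrightarrow> f b = g b) \<Longrightarrow> Q f \<Longrightarrow> Q g"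
  shows "openin (product_topology (\<lambda>_. discrete_topology A) I)
    {f \<in> topspace (product_topology (\<lambda>_. discrete_topology A) I). Q f}"
    (is "openin ?X ?S")
proof (subst openin_subopen, intro ballI)
  fix f assume f: "f \<in> ?S"
  let ?N = "topspace ?X \<inter> (\<Inter>b\<in>B. {g \<in> topspace ?X. g b \<in> {f b}})"
  have "openin ?X {g \<in> topspace ?X. g b \<in> {f b}}" if b: "b \<in> B" for b
  proof (rule openin_continuous_map_preimage)
    show "continuous_map ?X (discrete_topology A) (\<lambda>g. g b)"
      using b B(2) by (intro continuous_map_product_projection[where X="\<lambda>_. discrete_topology A"]) auto
    show "openin (discrete_topology A) {f b}"
      using f b B(2) by auto
  qed
  then have "openin ?X ?N"
    using B(1) by (intro openin_Int_Inter[OF _ openin_topspace]) auto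
  moreover have "f \<in> ?N"
    using f by auto
  moreover have "?N \<subseteq> ?S"
    using f det[of f] by auto
  ultimately show "\<exists>N. openin ?X N \<and> f \<in> N \<and> N \<subseteq> ?S"
    by (intro exI[of _ ?N] conjI)
qed

lemma closedin_finitely_determined:
  assumes B: "finite B" "B \<subseteq> I"
    and det: "\<And>f g. f \<in> topspace (product_topology (\<lambda>_. discrete_topology A) I) \<Longrightarrow>
      g \<in> topspace (product_topology (\<lambda>_. discrete_topology A) I) \<Longrightarrow>
      (\<And>b. b \<in> B \<Longrightarrow> f b = g b) \<Longrightarrow> Q f \<Longrightarrow> Q g"
  shows "closedin (product_topology (\<lambda>_. discrete_topology A) I)
    {f \<in> topspace (product_topology (\<lambda>_. discrete_topology A) I). Q f}"
    (is "closedin ?X ?S")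
proof -
  have "openin ?X {f \<in> topspace ?X. \<not> Q f}"
    using det by (intro openin_finitely_determined[OF B]) metis
  moreover have "topspace ?X - ?S = {f \<in> topspace ?X. \<not> Q f}"
    by auto
  ultimately show ?thesis
    unfolding closedin_def by auto
qed

lemma compact_space_finite_power:
  "finite A \<Longrightarrow> compact_space (product_topology (\<lambda>_. discrete_topology A) I)"
  by (simp add: compact_space_product_topology compact_space_discrete_topology)

text \<open>The restrictions of homomorphisms to the carrier form a closed subset of the compact power
  \<open>F\<^sup>G\<close>, so a cluster point of a sequence of homomorphisms is again a homomorphism: multiplicativity
  at \<open>x\<close> and \<open>y\<close> concerns three values only.\<close>

lemma hom_cluster_point:
  assumes "group G" and F: "finite (carrier F)" and \<phi>: "\<And>i::nat. \<phi> i \<in> hom G F"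
  shows "\<exists>\<psi>\<in>hom G F. \<forall>B m. finite B \<longrightarrow> B \<subseteq> carrier G \<longrightarrow> (\<exists>i\<ge>m. \<forall>x\<in>B. \<phi> i x = \<psi> x)"
proof -
  interpret group G by fact
  let ?X = "product_topology (\<lambda>_. discrete_topology (carrier F)) (carrier G)"
  let ?r = "\<lambda>i. restrict (\<phi> i) (carrier G)"
  have r: "?r i \<in> topspace ?X" for i
    using hom_in_carrier[OF \<phi>] by auto
  have "\<exists>\<psi>\<in>topspace ?X. \<forall>m\<in>UNIV. \<psi> \<in> ?X closure_of (?r ` {m..})"
  proof (rule compact_space_fip_family[OF compact_space_finite_power[OF F]])
    show "closedin ?X (?X closure_of (?r ` {m..}))" for m
      by (rule closedin_closure_of)
    fix J :: "nat set" assume J: "finite J"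
    have "?r (Max J) \<in> ?X closure_of (?r ` {m..})" if "m \<in> J" for m
    proof -
      have "?r (Max J) \<in> ?r ` {m..}"
        using J that by auto
      then show ?thesis
        using closure_of_subset[of "?r ` {m..}" ?X] r by blast
    qed
    then show "\<exists>x\<in>topspace ?X. \<forall>m\<in>J. x \<in> ?X closure_of (?r ` {m..})"
      using r by blast
  qed
  then obtain \<psi> where \<psi>: "\<psi> \<in> topspace ?X" "\<And>m. \<psi> \<in> ?X closure_of (?r ` {m..})"
    by blast
  have cl: "\<exists>i\<ge>m. \<forall>x\<in>B. \<phi> i x = \<psi> x" if B: "finite B" "B \<subseteq> carrier G" for B m
  proof -
    define N where "N = {f \<in> topspace ?X. \<forall>x\<in>B. f x = \<psi> x}"
    have "openin ?X N"
      unfolding N_def by (rule openin_finitely_determined[OF B]) auto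
    moreover have "\<psi> \<in> N"
      using \<psi>(1) by (simp add: N_def)
    moreover note \<psi>(2)[of m, unfolded in_closure_of, THEN conjunct2, THEN spec, of N]
    ultimately have "\<exists>f. f \<in> ?r ` {m..} \<and> f \<in> N"
      by simp
    then obtain i where "i \<ge> m" "?r i \<in> N"
      by (elim exE conjE imageE) simp
    then show ?thesis
      using B(2) by (intro exI[of _ i]) (auto simp: N_def subset_iff)
  qed
  have "\<psi> \<in> hom G F"
  proof (rule homI)
    fix x y assume xy: "x \<in> carrier G" "y \<in> carrier G"
    show "\<psi> x \<in> carrier F"
      using xy \<psi>(1) by auto
    obtain i where "\<forall>z\<in>{x, y, x \<otimes>\<^bsub>G\<^esub> y}. \<phi> i z = \<psi> z"
      using cl[of "{x, y, x \<otimes>\<^bsub>G\<^esub> y}" 0] xy by auto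
    then have "\<phi> i x = \<psi> x" "\<phi> i y = \<psi> y" "\<phi> i (x \<otimes>\<^bsub>G\<^esub> y) = \<psi> (x \<otimes>\<^bsub>G\<^esub> y)"
      by blast+
    then show "\<psi> (x \<otimes>\<^bsub>G\<^esub> y) = \<psi> x \<otimes>\<^bsub>F\<^esub> \<psi> y"
      using hom_mult[OF \<phi> xy, of i] by metis
  qed
  then show ?thesis using cl by blast
qed

context top_group
begin

lemma openin_hom_preimage:
  assumes "\<And>c. openin T {x \<in> carrier G. \<phi> x = c}"
  shows "openin T {x \<in> carrier G. \<phi> x \<in> C}"
proof -
  have "{x \<in> carrier G. \<phi> x \<in> C} = (\<Union>c\<in>C. {x \<in> carrier G. \<phi> x = c})"
    by auto
  then show ?thesis
    using assms by auto
qed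

lemma closedin_hom_preimage:
  assumes "\<And>c. openin T {x \<in> carrier G. \<phi> x = c}"
  shows "closedin T {x \<in> carrier G. \<phi> x \<in> C}"
proof -
  have "topspace T - {x \<in> carrier G. \<phi> x \<in> C} = {x \<in> carrier G. \<phi> x \<in> - C}"
    by auto
  then show ?thesis
    using openin_hom_preimage[OF assms, of "- C"] unfolding closedin_def by auto
qed

lemma closedin_hom_fibre:
  assumes "\<And>c. openin T {x \<in> carrier G. \<phi> x = c}"
  shows "closedin T {x \<in> carrier G. \<phi> x = c}"
  using closedin_hom_preimage[OF assms, of "{c}"] by simp

end

context compact_group
begin

text \<open>This is where the continuity of all abstract homomorphisms into \<open>F\<close> is used. If it fails, there
  are homomorphisms \<open>\<phi>\<^sub>n\<close> and elements \<open>g\<^sub>n\<close> such that \<open>\<phi>\<^sub>n\<close> does not kill \<open>g\<^sub>n\<close> while all earlier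
  ones do. A cluster point \<open>\<psi>\<close> of the sequence is a homomorphism, hence continuous, and kills the
  intersection of the kernels of the \<open>\<phi>\<^sub>n\<close>; by compactness it kills the intersection of the
  first \<open>k\<close> of these kernels. Now an infinite product \<open>x\<close> of some of the \<open>g\<^sub>n\<close> with \<open>n \<ge> k\<close> is formed: the factor
  \<open>g\<^sub>n\<close> is used exactly if \<open>\<phi>\<^sub>n\<close> kills the product so far. No later factor changes the value of
  \<open>\<phi>\<^sub>n\<close>, so no \<open>\<phi>\<^sub>n\<close> with \<open>n \<ge> k\<close> kills \<open>x\<close>, although \<open>\<psi>\<close> does. Hence \<open>\<psi>\<close> is no cluster
  point, a contradiction.\<close>

lemma finitely_many_homs_have_common_kernel:
  assumes F: "group F" "finite (carrier F)"
    and cont: "\<And>\<phi> c. \<phi> \<in> hom G F \<Longrightarrow> openin T {x \<in> carrier G. \<phi> x = c}"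
  shows "\<exists>A. finite A \<and> A \<subseteq> hom G F \<and>
    (\<forall>x\<in>carrier G. (\<forall>\<phi>\<in>A. \<phi> x = \<one>\<^bsub>F\<^esub>) \<longrightarrow> (\<forall>\<psi>\<in>hom G F. \<psi> x = \<one>\<^bsub>F\<^esub>))"
proof (rule ccontr)
  assume no: "\<not> ?thesis"
  interpret F: group F by fact
  have "\<forall>A. \<exists>\<psi> x. finite A \<and> A \<subseteq> hom G F \<longrightarrow>
      x \<in> carrier G \<and> (\<forall>\<phi>\<in>A. \<phi> x = \<one>\<^bsub>F\<^esub>) \<and> \<psi> \<in> hom G F \<and> \<psi> x \<noteq> \<one>\<^bsub>F\<^esub>"
  proof
    fix A
    show "\<exists>\<psi> x. finite A \<and> A \<subseteq> hom G F \<longrightarrow>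
      x \<in> carrier G \<and> (\<forall>\<phi>\<in>A. \<phi> x = \<one>\<^bsub>F\<^esub>) \<and> \<psi> \<in> hom G F \<and> \<psi> x \<noteq> \<one>\<^bsub>F\<^esub>"
      using no[unfolded not_ex, THEN spec, of A] by auto
  qed
  then obtain \<Phi> \<Gamma> where step: "\<And>A. finite A \<Longrightarrow> A \<subseteq> hom G F \<Longrightarrow>
      \<Gamma> A \<in> carrier G \<and> (\<forall>\<phi>\<in>A. \<phi> (\<Gamma> A) = \<one>\<^bsub>F\<^esub>) \<and> \<Phi> A \<in> hom G F \<and> \<Phi> A (\<Gamma> A) \<noteq> \<one>\<^bsub>F\<^esub>"
    by metis
  define A where "A = (\<lambda>n. ((\<lambda>A. insert (\<Phi> A) A) ^^ n) {})"
  define \<phi> where "\<phi> n = \<Phi> (A n)" for n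
  define g where "g n = \<Gamma> (A n)" for n
  have A_Suc: "A (Suc n) = insert (\<phi> n) (A n)" for n
    by (simp add: A_def \<phi>_def)
  have A: "finite (A n) \<and> A n \<subseteq> hom G F" for n
  proof (induction n)
    case (Suc n)
    then show ?case
      using step[of "A n"] by (simp add: A_Suc \<phi>_def)
  qed (simp add: A_def)
  have \<phi>: "\<phi> n \<in> hom G F" and g: "g n \<in> carrier G" and \<phi>g: "\<phi> n (g n) \<noteq> \<one>\<^bsub>F\<^esub>" for n
    using step[of "A n"] A[of n] by (auto simp: \<phi>_def g_def)
  have mem: "\<phi> i \<in> A n" if "i < n" for i n
    using that
  proof (induction n)
    case (Suc n)
    then show ?case by (cases "i = n") (auto simp: A_Suc)
  qed simp
  have \<phi>g1: "\<phi> i (g n) = \<one>\<^bsub>F\<^esub>" if "i < n" for i n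
    using step[of "A n"] A[of n] mem[OF that] by (auto simp: g_def)
  obtain \<psi> where \<psi>: "\<psi> \<in> hom G F"
    and cluster: "\<And>B m. finite B \<Longrightarrow> B \<subseteq> carrier G \<Longrightarrow> \<exists>i\<ge>m. \<forall>x\<in>B. \<phi> i x = \<psi> x"
    using hom_cluster_point[OF is_group F(2), of \<phi>] \<phi> by blast
  have cluster1: "\<exists>i\<ge>m. \<phi> i x = \<psi> x" if "x \<in> carrier G" for x m
    using cluster[of "{x}" m] that by simp
  have "\<exists>k. \<forall>x\<in>carrier G. (\<forall>i<k. \<phi> i x = \<one>\<^bsub>F\<^esub>) \<longrightarrow> \<psi> x = \<one>\<^bsub>F\<^esub>"
  proof (rule ccontr)
    assume neg: "\<not> ?thesis"
    have "\<exists>x\<in>topspace T. \<forall>i\<in>UNIV. x \<in> {x \<in> carrier G. \<phi> i x = \<one>\<^bsub>F\<^esub>} \<inter> {x \<in> carrier G. \<psi> x \<in> - {\<one>\<^bsub>F\<^esub>}}"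
    proof (rule compact_space_fip_family[OF compact])
      show "closedin T ({x \<in> carrier G. \<phi> i x = \<one>\<^bsub>F\<^esub>} \<inter> {x \<in> carrier G. \<psi> x \<in> - {\<one>\<^bsub>F\<^esub>}})" for i
        using cont[OF \<phi>] cont[OF \<psi>]
        by (intro closedin_Int closedin_hom_fibre closedin_hom_preimage)
      fix J :: "nat set" assume J: "finite J"
      obtain x where x: "x \<in> carrier G" "\<forall>i<Suc (Max J). \<phi> i x = \<one>\<^bsub>F\<^esub>" "\<psi> x \<noteq> \<one>\<^bsub>F\<^esub>"
        using neg by blast
      have "i < Suc (Max J)" if "i \<in> J" for i
        using J that by (simp add: le_imp_less_Suc)
      then show "\<exists>x\<in>topspace T. \<forall>i\<in>J. x \<in> {x \<in> carrier G. \<phi> i x = \<one>\<^bsub>F\<^esub>} \<inter> {x \<in> carrier G. \<psi> x \<in> - {\<one>\<^bsub>F\<^esub>}}"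
        using x by auto
    qed
    then obtain x where "x \<in> carrier G" "\<And>i. \<phi> i x = \<one>\<^bsub>F\<^esub>" "\<psi> x \<noteq> \<one>\<^bsub>F\<^esub>"
      by auto
    then show False
      using cluster1[of x 0] by auto
  qed
  then obtain k where k: "\<And>x. x \<in> carrier G \<Longrightarrow> (\<And>i. i < k \<Longrightarrow> \<phi> i x = \<one>\<^bsub>F\<^esub>) \<Longrightarrow> \<psi> x = \<one>\<^bsub>F\<^esub>"
    by blast
  \<comment> \<open>The partial products; \<open>g n\<close> enters only when this makes \<open>\<phi> n\<close> nontrivial on the product.\<close>
  define p where "p = rec_nat \<one> (\<lambda>n q. if k \<le> n \<and> \<phi> n q = \<one>\<^bsub>F\<^esub> then q \<otimes> g n else q)"
  have p_0: "p 0 = \<one>" by (simp add: p_def)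
  have p_Suc: "p (Suc n) = (if k \<le> n \<and> \<phi> n (p n) = \<one>\<^bsub>F\<^esub> then p n \<otimes> g n else p n)" for n
    by (simp add: p_def)
  have p: "p n \<in> carrier G" for n
    by (induction n) (auto simp: p_0 p_Suc g)
  have \<psi>p: "\<psi> (p n) = \<one>\<^bsub>F\<^esub>" for n
  proof (induction n)
    case 0
    then show ?case using hom_one[OF \<psi> is_group F(1)] by (simp add: p_0)
  next
    case (Suc n)
    have "\<psi> (g n) = \<one>\<^bsub>F\<^esub>" if "k \<le> n"
      using that by (intro k g \<phi>g1) simp
    then show ?case
      using Suc hom_mult[OF \<psi> p g, of n n] by (simp add: p_Suc)
  qed
  have \<phi>p: "\<phi> n (p (Suc n)) \<noteq> \<one>\<^bsub>F\<^esub>" if "k \<le> n" for n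
    using that hom_mult[OF \<phi> p g, of n n n] \<phi>g[of n] hom_in_carrier[OF \<phi> g, of n n]
    by (simp add: p_Suc)
  have step_eq: "\<phi> n (p (Suc m)) = \<phi> n (p m)" if "n < m" for n m
    using hom_mult[OF \<phi> p g, of n m m] \<phi>g1[OF that] hom_in_carrier[OF \<phi> p, of n m]
    by (simp add: p_Suc)
  have stable: "\<phi> n (p (Suc n + j)) = \<phi> n (p (Suc n))" for n j
  proof (induction j)
    case (Suc j)
    then show ?case using step_eq[of n "Suc n + j"] by simp
  qed simp
  \<comment> \<open>The infinite product need not converge; compactness provides an element on which every \<open>\<phi> n\<close> takes
    the value that it eventually takes on the partial products.\<close>
  have "\<exists>x\<in>topspace T. \<forall>n\<in>UNIV. x \<in> {x \<in> carrier G. \<phi> n x = \<phi> n (p (Suc n))} \<inter> {x \<in> carrier G. \<psi> x = \<one>\<^bsub>F\<^esub>}"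
  proof (rule compact_space_fip_family[OF compact])
    show "closedin T ({x \<in> carrier G. \<phi> n x = \<phi> n (p (Suc n))} \<inter> {x \<in> carrier G. \<psi> x = \<one>\<^bsub>F\<^esub>})" for n
      using cont[OF \<phi>] cont[OF \<psi>] by (intro closedin_Int closedin_hom_fibre)
    fix J :: "nat set" assume J: "finite J"
    have "\<phi> n (p (Suc (Max J))) = \<phi> n (p (Suc n))" if "n \<in> J" for n
    proof -
      obtain j where "Max J = n + j"
        using le_Suc_ex[OF Max_ge[OF J \<open>n \<in> J\<close>]] by auto
      then show ?thesis using stable[of n j] by simp
    qed
    then show "\<exists>x\<in>topspace T. \<forall>n\<in>J. x \<in> {x \<in> carrier G. \<phi> n x = \<phi> n (p (Suc n))} \<inter> {x \<in> carrier G. \<psi> x = \<one>\<^bsub>F\<^esub>}"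
      using p \<psi>p by (intro bexI[of _ "p (Suc (Max J))"]) auto
  qed
  then obtain x where x: "x \<in> carrier G" "\<And>n. \<phi> n x = \<phi> n (p (Suc n))" "\<psi> x = \<one>\<^bsub>F\<^esub>"
    by auto
  obtain i where "i \<ge> k" "\<phi> i x = \<psi> x"
    using cluster1[OF x(1)] by blast
  then show False
    using x \<phi>p by auto
qed

lemma openin_hom_class:
  assumes F: "group F" "finite (carrier F)"
    and cont: "\<And>\<phi> c. \<phi> \<in> hom G F \<Longrightarrow> openin T {x \<in> carrier G. \<phi> x = c}"
    and d: "d \<in> carrier G"
  shows "openin T (hom_class G F d)"
proof -
  obtain A where A: "finite A" "A \<subseteq> hom G F"
    and ker: "\<And>x \<psi>. x \<in> carrier G \<Longrightarrow> (\<And>\<phi>. \<phi> \<in> A \<Longrightarrow> \<phi> x = \<one>\<^bsub>F\<^esub>) \<Longrightarrow> \<psi> \<in> hom G F \<Longrightarrow> \<psi> x = \<one>\<^bsub>F\<^esub>"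
    using finitely_many_homs_have_common_kernel[OF F cont] by meson
  have "\<psi> x = \<psi> d" if x: "x \<in> carrier G" "\<And>\<phi>. \<phi> \<in> A \<Longrightarrow> \<phi> x = \<phi> d" and \<psi>: "\<psi> \<in> hom G F" for x \<psi>
  proof -
    have "\<psi> (inv d \<otimes> x) = \<one>\<^bsub>F\<^esub>"
    proof (rule ker[OF _ _ \<psi>])
      fix \<phi> assume "\<phi> \<in> A"
      then show "\<phi> (inv d \<otimes> x) = \<one>\<^bsub>F\<^esub>"
        using hom_eq_iff_quotient[OF is_group F(1), of \<phi> x d] A(2) x d by auto
    qed (use x d in simp)
    then show ?thesis
      using hom_eq_iff_quotient[OF is_group F(1) \<psi> x(1) d] by simp
  qed
  then have "hom_class G F d = topspace T \<inter> (\<Inter>\<phi>\<in>A. {x \<in> carrier G. \<phi> x = \<phi> d})"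
    using A(2) by (auto simp: hom_class_def)
  also have "openin T \<dots>"
    using A cont by (intro openin_Int_Inter[OF _ openin_topspace]) auto
  finally show ?thesis .
qed

lemma strongly_complete_openin_fibre:
  assumes sc: "strongly_complete G T" and F: "group F" "finite (carrier F)" and \<phi>: "\<phi> \<in> hom G F"
  shows "openin T {x \<in> carrier G. \<phi> x = c}"
proof (rule openin_hom_fibre[OF F(1) \<phi>])
  interpret \<phi>: group_hom G F \<phi>
    using F \<phi> is_group by (simp add: group_hom_def group_hom_axioms_def)
  let ?K = "kernel G F \<phi>"
  have "finite (rcosets ?K)"
  proof -
    have "inj_on (\<lambda>X. the_elem (\<phi> ` X)) (carrier (G Mod ?K))"
      by (rule \<phi>.FactGroup_inj_on)
    moreover have "(\<lambda>X. the_elem (\<phi> ` X)) ` carrier (G Mod ?K) \<subseteq> carrier F"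
      using \<phi>.FactGroup_the_elem_mem by blast
    ultimately have "finite (carrier (G Mod ?K))"
      using F(2) inj_on_finite by blast
    then show ?thesis by (simp add: FactGroup_def)
  qed
  then show "openin T ?K"
    using sc \<phi>.subgroup_kernel by (auto simp: strongly_complete_def)
qed

end

section \<open>Kernels defined by solvability of equations\<close>

text \<open>A triple \<open>(i, j, k)\<close> stands for the equation \<open>y\<^sub>i y\<^sub>j = y\<^sub>k\<close>. Equations of this shape suffice because
  they can express any finite part of a multiplication table. Assignments are total on \<open>nat\<close>, and
  the variable \<open>0\<close> is the distinguished one.\<close>

definition solves ::
    "('a, 'm) monoid_scheme \<Rightarrow> (nat \<times> nat \<times> nat) list \<Rightarrow> (nat \<Rightarrow> 'a) \<Rightarrow> bool" where
  "solves G R y \<longleftrightarrow> range y \<subseteq> carrier G \<and> (\<forall>(i, j, k)\<in>set R. y i \<otimes>\<^bsub>G\<^esub> y j = y k)"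

definition solution_set ::
    "('a, 'm) monoid_scheme \<Rightarrow> (nat \<times> nat \<times> nat) list \<Rightarrow> 'a set" where
  "solution_set G R = {y 0 | y. solves G R y}"

definition forces_trivial ::
    "('c, 'k) monoid_scheme \<Rightarrow> (nat \<times> nat \<times> nat) list \<Rightarrow> bool" where
  "forces_trivial F R \<longleftrightarrow> (\<forall>y. solves F R y \<longrightarrow> y 0 = \<one>\<^bsub>F\<^esub>)"

lemma solution_set_killed:
  assumes R: "forces_trivial F R" and x: "x \<in> solution_set G R" and \<phi>: "\<phi> \<in> hom G F"
  shows "\<phi> x = \<one>\<^bsub>F\<^esub>"
proof -
  obtain y where y: "solves G R y" "x = y 0"
    using x by (auto simp: solution_set_def)
  have c: "y i \<in> carrier G" for i
    using y(1) by (auto simp: solves_def)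
  have "\<phi> (y i) \<otimes>\<^bsub>F\<^esub> \<phi> (y j) = \<phi> (y k)" if "(i, j, k) \<in> set R" for i j k
    using hom_mult[OF \<phi> c c, of i j] y(1) that by (auto simp: solves_def)
  moreover have "\<phi> (y i) \<in> carrier F" for i
    using hom_in_carrier[OF \<phi> c] .
  ultimately have "solves F R (\<lambda>i. \<phi> (y i))"
    by (auto simp: solves_def)
  then show ?thesis
    using R y(2) by (simp add: forces_trivial_def)
qed

lemma solution_set_subset_carrier: "solution_set G R \<subseteq> carrier G"
  by (auto simp: solution_set_def solves_def)

lemma one_in_solution_set:
  assumes "group G"
  shows "\<one>\<^bsub>G\<^esub> \<in> solution_set G R"
proof -
  interpret group G by fact
  have "solves G R (\<lambda>_. \<one>\<^bsub>G\<^esub>)"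
    by (auto simp: solves_def)
  then show ?thesis
    by (auto simp: solution_set_def)
qed

text \<open>Suppose that no finite system of equations forces \<open>x\<close> to be killed. Then for every finite set of
  pairs in \<open>G\<close> there is a map to \<open>F\<close> that is multiplicative on these pairs and nontrivial at \<open>x\<close>,
  namely a solution in \<open>F\<close> of the part of the multiplication table that involves them. By
  compactness of \<open>F\<^sup>G\<close> one map is multiplicative everywhere and nontrivial at \<open>x\<close>.\<close>

lemma killed_imp_in_solution_set:
  assumes "group G" and F: "finite (carrier F)" and x: "x \<in> carrier G"
    and kill: "\<And>\<phi>. \<phi> \<in> hom G F \<Longrightarrow> \<phi> x = \<one>\<^bsub>F\<^esub>"
  shows "\<exists>R. forces_trivial F R \<and> x \<in> solution_set G R"
proof (rule ccontr)
  assume no: "\<not> ?thesis"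
  interpret group G by fact
  let ?X = "product_topology (\<lambda>_. discrete_topology (carrier F)) (carrier G)"
  define C where "C = (\<lambda>(a, b). {f \<in> topspace ?X. f (a \<otimes>\<^bsub>G\<^esub> b) = f a \<otimes>\<^bsub>F\<^esub> f b \<and> f x \<noteq> \<one>\<^bsub>F\<^esub>})"
  have "\<exists>f\<in>topspace ?X. \<forall>p\<in>carrier G \<times> carrier G. f \<in> C p"
  proof (rule compact_space_fip_family[OF compact_space_finite_power[OF F]])
    fix p assume p: "p \<in> carrier G \<times> carrier G"
    then obtain a b where ab: "p = (a, b)" "a \<in> carrier G" "b \<in> carrier G" by auto
    show "closedin ?X (C p)"
      unfolding ab(1) C_def prod.case
      by (rule closedin_finitely_determined[of "{a, b, a \<otimes>\<^bsub>G\<^esub> b, x}"]) (use ab x in auto)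
  next
    fix J assume J: "finite J" "J \<subseteq> carrier G \<times> carrier G"
    define E where "E = insert x (\<Union>(a, b)\<in>J. {a, b, a \<otimes>\<^bsub>G\<^esub> b})"
    have E: "finite E" "E \<subseteq> carrier G" "x \<in> E"
      using J x by (auto simp: E_def)
    obtain g :: "'a \<Rightarrow> nat" where g: "inj_on g E"
      using finite_imp_inj_to_nat_seg[OF E(1)] by auto
    \<comment> \<open>Variable names for the elements of \<open>E\<close>; the element \<open>x\<close> receives the distinguished variable.\<close>
    define idx where "idx z = (if z = x then 0 else Suc (g z))" for z
    have idx: "inj_on idx E"
      using g by (auto simp: inj_on_def idx_def)
    define y where "y n = (if n \<in> idx ` E then inv_into E idx n else \<one>\<^bsub>G\<^esub>)" for n
    have y_idx: "y (idx z) = z" if "z \<in> E" for z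
      using that idx by (simp add: y_def)
    have y_carrier: "y n \<in> carrier G" for n
      using E(2) inv_into_into[of n idx E] by (auto simp: y_def)
    have "\<exists>R. set R = (\<lambda>(a, b). (idx a, idx b, idx (a \<otimes>\<^bsub>G\<^esub> b))) ` J"
      by (intro finite_list finite_imageI J(1))
    then obtain R where R: "set R = (\<lambda>(a, b). (idx a, idx b, idx (a \<otimes>\<^bsub>G\<^esub> b))) ` J" ..
    have memE: "a \<in> E" "b \<in> E" "a \<otimes>\<^bsub>G\<^esub> b \<in> E" if "(a, b) \<in> J" for a b
      using that by (auto simp: E_def)
    have "solves G R y"
      using y_carrier memE by (auto simp: solves_def R y_idx)
    moreover have "y 0 = x"
      using y_idx[OF E(3)] by (simp add: idx_def)
    ultimately have "x \<in> solution_set G R"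
      by (auto simp: solution_set_def)
    then have "\<not> forces_trivial F R"
      using no by auto
    then obtain v where v: "solves F R v" "v 0 \<noteq> \<one>\<^bsub>F\<^esub>"
      by (auto simp: forces_trivial_def)
    define f where "f = restrict (\<lambda>z. v (idx z)) (carrier G)"
    have "f \<in> topspace ?X"
      using v(1) by (auto simp: f_def solves_def)
    moreover have "f \<in> C p" if p: "p \<in> J" for p
    proof -
      obtain a b where ab: "p = (a, b)" by (cases p)
      have c: "a \<in> carrier G" "b \<in> carrier G"
        using p ab J(2) by auto
      have "(idx a, idx b, idx (a \<otimes>\<^bsub>G\<^esub> b)) \<in> set R"
        using imageI[OF p, of "\<lambda>(a, b). (idx a, idx b, idx (a \<otimes>\<^bsub>G\<^esub> b))"] by (simp add: ab R)
      then have "v (idx a) \<otimes>\<^bsub>F\<^esub> v (idx b) = v (idx (a \<otimes>\<^bsub>G\<^esub> b))"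
        using v(1) by (auto simp: solves_def)
      moreover have "f x \<noteq> \<one>\<^bsub>F\<^esub>"
        using v(2) x by (simp add: f_def idx_def)
      ultimately show ?thesis
        using c \<open>f \<in> topspace ?X\<close> by (simp add: ab C_def f_def)
    qed
    ultimately show "\<exists>f\<in>topspace ?X. \<forall>p\<in>J. f \<in> C p"
      by (intro bexI[of _ f]) auto
  qed
  then obtain f where f: "f \<in> topspace ?X" "\<And>a b. a \<in> carrier G \<Longrightarrow> b \<in> carrier G \<Longrightarrow> f \<in> C (a, b)"
    by auto
  have "f \<in> hom G F"
    using f by (intro homI) (auto simp: C_def)
  moreover have "f x \<noteq> \<one>\<^bsub>F\<^esub>"
    using f(2)[OF x x] by (simp add: C_def)
  ultimately show False
    using kill by blast
qed

text \<open>The unknowns of the two systems are kept apart by parity. Their distinguished variables become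
  \<open>1\<close> and \<open>2\<close>, and \<open>0\<close> is left for the product of these.\<close>

definition product_relations ::
    "(nat \<times> nat \<times> nat) list \<Rightarrow> (nat \<times> nat \<times> nat) list \<Rightarrow> (nat \<times> nat \<times> nat) list" where
  "product_relations R R' = (1, 2, 0) #
     map (\<lambda>(i, j, k). (2 * i + 1, 2 * j + 1, 2 * k + 1)) R @
     map (\<lambda>(i, j, k). (2 * i + 2, 2 * j + 2, 2 * k + 2)) R'"

lemma solves_product_relations:
  "solves G (product_relations R R') y \<longleftrightarrow>
     range y \<subseteq> carrier G \<and> y 1 \<otimes>\<^bsub>G\<^esub> y 2 = y 0 \<and>
     (\<forall>(i, j, k)\<in>set R. y (2 * i + 1) \<otimes>\<^bsub>G\<^esub> y (2 * j + 1) = y (2 * k + 1)) \<and>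
     (\<forall>(i, j, k)\<in>set R'. y (2 * i + 2) \<otimes>\<^bsub>G\<^esub> y (2 * j + 2) = y (2 * k + 2))"
  unfolding solves_def product_relations_def
  by (simp add: ball_Un split_beta)

lemma forces_trivial_product:
  assumes "group F" and R: "forces_trivial F R" and R': "forces_trivial F R'"
  shows "forces_trivial F (product_relations R R')"
  unfolding forces_trivial_def
proof (intro allI impI)
  fix y assume y: "solves F (product_relations R R') y"
  interpret F: group F by fact
  have "range y \<subseteq> carrier F"
    using y by (simp add: solves_def)
  then have "solves F R (\<lambda>n. y (2 * n + 1))" "solves F R' (\<lambda>n. y (2 * n + 2))"
    using y unfolding solves_product_relations by (auto simp: solves_def image_subset_iff)
  then have "y (2 * 0 + 1) = \<one>\<^bsub>F\<^esub>" "y (2 * 0 + 2) = \<one>\<^bsub>F\<^esub>"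
    using R R' unfolding forces_trivial_def by blast+
  then have "y 1 = \<one>\<^bsub>F\<^esub>" "y 2 = \<one>\<^bsub>F\<^esub>"
    by (simp_all add: numeral_2_eq_2)
  moreover have "y 1 \<otimes>\<^bsub>F\<^esub> y 2 = y 0"
    using y by (simp add: solves_product_relations)
  ultimately show "y 0 = \<one>\<^bsub>F\<^esub>"
    by simp
qed

lemma mult_in_solution_set_product:
  assumes "group G" and a: "a \<in> solution_set G R" and b: "b \<in> solution_set G R'"
  shows "a \<otimes>\<^bsub>G\<^esub> b \<in> solution_set G (product_relations R R')"
proof -
  interpret group G by fact
  obtain u v where u: "solves G R u" "u 0 = a" and v: "solves G R' v" "v 0 = b"
    using a b by (auto simp: solution_set_def)
  define y where "y n = (if n = 0 then a \<otimes>\<^bsub>G\<^esub> b else if odd n then u (n div 2) else v (n div 2 - 1))" for n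
  have y: "y 0 = a \<otimes>\<^bsub>G\<^esub> b" "y (2 * n + 1) = u n" "y (2 * n + 2) = v n" for n
    by (auto simp: y_def)
  have y12: "y 1 = a" "y 2 = b"
    using y(2)[of 0] y(3)[of 0] u v by (auto simp: numeral_2_eq_2)
  have uv: "u n \<in> carrier G" "v n \<in> carrier G" for n
    using u(1) v(1) by (auto simp: solves_def)
  have ab: "a \<in> carrier G" "b \<in> carrier G"
    using uv[of 0] u(2) v(2) by auto
  have "y n \<in> carrier G" for n
    using uv ab by (simp add: y_def)
  then have "solves G (product_relations R R') y"
    using u(1) v(1) unfolding solves_product_relations y y12 by (auto simp: solves_def)
  then show ?thesis
    using y(1) unfolding solution_set_def by (intro CollectI exI[of _ y]) simp
qed

text \<open>The solution set of a product system contains both factors' solution sets, since each of them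
  contains the unit.\<close>

lemma solution_sets_directed:
  assumes "group G" "group F" and "finite \<R>" and "\<And>R. R \<in> \<R> \<Longrightarrow> forces_trivial F R"
  shows "\<exists>S. forces_trivial F S \<and> (\<forall>R\<in>\<R>. solution_set G R \<subseteq> solution_set G S)"
  using assms(3,4)
proof (induction \<R>)
  case empty
  \<comment> \<open>The equation \<open>y\<^sub>0 y\<^sub>0 = y\<^sub>0\<close> has only the trivial solution in a group.\<close>
  have "forces_trivial F [(0, 0, 0)]"
    unfolding forces_trivial_def solves_def
  proof (intro allI impI)
    fix y :: "nat \<Rightarrow> _"
    assume "range y \<subseteq> carrier F \<and> (\<forall>(i, j, k)\<in>set [(0, 0, 0)]. y i \<otimes>\<^bsub>F\<^esub> y j = y k)"
    then have "y 0 \<in> carrier F" "y 0 \<otimes>\<^bsub>F\<^esub> y 0 = y 0" by auto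
    then show "y 0 = \<one>\<^bsub>F\<^esub>"
      using group.r_cancel_one[OF \<open>group F\<close>] by metis
  qed
  then show ?case by auto
next
  case (insert R \<R>)
  then obtain S where S: "forces_trivial F S" "\<And>R. R \<in> \<R> \<Longrightarrow> solution_set G R \<subseteq> solution_set G S"
    by auto
  interpret group G by fact
  let ?S = "product_relations R S"
  have "solution_set G R \<subseteq> solution_set G ?S"
  proof
    fix x assume x: "x \<in> solution_set G R"
    then show "x \<in> solution_set G ?S"
      using mult_in_solution_set_product[OF \<open>group G\<close> x one_in_solution_set[OF \<open>group G\<close>], of S]
        solution_set_subset_carrier[of G R] by auto
  qed
  moreover have "solution_set G S \<subseteq> solution_set G ?S"
  proof
    fix x assume x: "x \<in> solution_set G S"
    then show "x \<in> solution_set G ?S"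
      using mult_in_solution_set_product[OF \<open>group G\<close> one_in_solution_set[OF \<open>group G\<close>] x, of R]
        solution_set_subset_carrier[of G S] by auto
  qed
  moreover have "forces_trivial F ?S"
    using forces_trivial_product[OF \<open>group F\<close> _ S(1)] insert.prems by auto
  ultimately show ?case
    using S(2) by (intro exI[of _ ?S]) auto
qed

context compact_group
begin

text \<open>The solutions form a closed, hence compact, subset of a power of \<open>G\<close>, and the solution set is
  its image under the projection to the distinguished coordinate.\<close>

lemma closedin_solution_set: "closedin T (solution_set G R)"
proof -
  let ?X = "product_topology (\<lambda>_. T) (UNIV :: nat set)"
  let ?Z = "topspace ?X \<inter> (\<Inter>(i, j, k)\<in>set R. {y \<in> topspace ?X. y i \<otimes> y j = y k})"
  have "closedin ?X {y \<in> topspace ?X. y i \<otimes> y j = y k}" for i j k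
    by (intro closedin_equalizer continuous_map_mult)
      (auto intro: continuous_map_product_projection[where X="\<lambda>_. T"])
  then have "closedin ?X (\<Inter>(insert (topspace ?X) ((\<lambda>(i, j, k). {y \<in> topspace ?X. y i \<otimes> y j = y k}) ` set R)))"
    by (intro closedin_Inter) (auto simp del: topspace_product_topology)
  then have "closedin ?X ?Z"
    by (simp del: topspace_product_topology)
  moreover have "compact_space ?X"
    using compact by (simp add: compact_space_product_topology)
  ultimately have "compactin ?X ?Z"
    using closedin_compact_space by blast
  moreover have "continuous_map ?X T (\<lambda>y. y 0)"
    by (rule continuous_map_product_projection) simp
  ultimately have "compactin T ((\<lambda>y. y 0) ` ?Z)"
    by (rule image_compactin)
  moreover have "?Z = {y. solves G R y}"
    by (auto simp: solves_def PiE_iff split_beta)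
  then have "(\<lambda>y. y 0) ` ?Z = solution_set G R"
    unfolding solution_set_def by (simp only: image_Collect)
  ultimately show ?thesis
    using compactin_imp_closedin[OF Hausdorff] by simp
qed

lemma regular_locally_compact: "locally_compact_space T \<and> regular_space T"
  using compact Hausdorff compact_imp_locally_compact_space compact_Hausdorff_imp_regular_space
  by blast

lemma closedin_hom_class:
  assumes opn: "\<And>d. d \<in> carrier G \<Longrightarrow> openin T (hom_class G F d)"
  shows "closedin T (hom_class G F c)"
proof -
  have eq: "topspace T - hom_class G F c = (\<Union>d\<in>carrier G - hom_class G F c. hom_class G F d)"
    by (fastforce simp: hom_class_def)
  have "openin T (topspace T - hom_class G F c)"
    unfolding eq using opn by (intro openin_Union) auto
  then show ?thesis
    by (auto simp: closedin_def hom_class_def)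
qed

text \<open>The common kernel is the union of the countably many closed sets \<open>solution_set G R\<close> with
  \<open>R\<close> forcing. As it is open and nonempty, one of them has interior by the Baire category
  theorem. By compactness finitely many translates of this interior, by elements of the common
  kernel, cover it; translation by \<open>z a\<^sup>-\<^sup>1\<close> is absorbed into the equations, because \<open>z a\<^sup>-\<^sup>1\<close>
  itself belongs to the solution set of a forcing system.\<close>

lemma hom_class_one_eq_solution_set:
  assumes F: "group F" "finite (carrier F)" and opn: "\<And>d. d \<in> carrier G \<Longrightarrow> openin T (hom_class G F d)"
  shows "\<exists>R. forces_trivial F R \<and> solution_set G R = hom_class G F \<one>"
proof -
  interpret F: group F by fact
  let ?N = "hom_class G F \<one>"
  have N: "x \<in> ?N \<longleftrightarrow> x \<in> carrier G \<and> (\<forall>\<phi>\<in>hom G F. \<phi> x = \<one>\<^bsub>F\<^esub>)" for x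
    using hom_one[OF _ is_group F(1)] by (auto simp: hom_class_def)
  have sub: "solution_set G R \<subseteq> ?N" if "forces_trivial F R" for R
  proof
    fix x assume x: "x \<in> solution_set G R"
    then show "x \<in> ?N"
      using solution_set_killed[OF that x] subsetD[OF solution_set_subset_carrier x] by (simp add: N)
  qed
  let ?\<S> = "solution_set G ` {R. forces_trivial F R}"
  have union: "\<Union>?\<S> = ?N"
  proof
    show "\<Union>?\<S> \<subseteq> ?N" using sub by auto
    show "?N \<subseteq> \<Union>?\<S>"
    proof
      fix x assume "x \<in> ?N"
      then obtain R where "forces_trivial F R" "x \<in> solution_set G R"
        using killed_imp_in_solution_set[OF is_group F(2), of x] by (auto simp: N)
      then show "x \<in> \<Union>?\<S>" by auto
    qed
  qed
  have "T interior_of (\<Union>?\<S>) \<noteq> {}"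
    unfolding union interior_of_openin[OF opn[OF one_closed]]
    by (auto simp: hom_class_def)
  moreover have "countable ?\<S>"
    by (intro countable_image) simp
  ultimately obtain S where S: "S \<in> ?\<S>" "T interior_of S \<noteq> {}"
    using Baire_category_alt[of T ?\<S>] regular_locally_compact closedin_solution_set by auto
  then obtain R where R: "forces_trivial F R" "T interior_of (solution_set G R) \<noteq> {}"
    by auto
  define U where "U = T interior_of (solution_set G R)"
  have U: "openin T U" "U \<subseteq> solution_set G R"
    by (auto simp: U_def interior_of_subset)
  obtain a where a: "a \<in> U"
    using R(2) by (auto simp: U_def)
  have aN: "a \<in> ?N"
    using a U(2) sub[OF R(1)] by auto
  have ac: "a \<in> carrier G"
    using aN by (simp add: N)
  have mult_N: "x \<otimes> inv y \<in> ?N" if "x \<in> ?N" "y \<in> ?N" for x y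
  proof -
    have xy: "x \<in> carrier G" "y \<in> carrier G" using that by (auto simp: N)
    have "\<phi> (x \<otimes> inv y) = \<one>\<^bsub>F\<^esub>" if \<phi>: "\<phi> \<in> hom G F" for \<phi>
    proof -
      have "\<phi> (inv y) = inv\<^bsub>F\<^esub> \<phi> y"
        using group_hom.hom_inv[of G F \<phi> y] F \<phi> is_group xy
        by (simp add: group_hom_def group_hom_axioms_def)
      moreover have "\<phi> x = \<one>\<^bsub>F\<^esub>" "\<phi> y = \<one>\<^bsub>F\<^esub>"
        using \<open>x \<in> ?N\<close> \<open>y \<in> ?N\<close> \<phi> unfolding N by blast+
      ultimately show ?thesis
        using hom_mult[OF \<phi> xy(1), of "inv y"] xy by simp
    qed
    then show ?thesis using xy by (simp add: N)
  qed
  define W where "W z = {x \<in> carrier G. a \<otimes> inv z \<otimes> x \<in> U}" for z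
  have W_open: "openin T (W z)" if "z \<in> ?N" for z
    using openin_continuous_map_preimage[OF continuous_map_translate[of "a \<otimes> inv z"] U(1)] that ac
    by (simp add: W_def N)
  have W_self: "z \<in> W z" if "z \<in> ?N" for z
    using that a ac by (simp add: W_def N m_assoc)
  have "compactin T ?N"
    using closedin_hom_class[OF opn] closedin_compact_space[OF compact] by simp
  note this[unfolded compactin_def, THEN conjunct2, THEN spec, of "W ` ?N"]
  then have "\<exists>\<F>. finite \<F> \<and> \<F> \<subseteq> W ` ?N \<and> ?N \<subseteq> \<Union>\<F>"
    using W_open W_self by auto
  then obtain \<F> where \<F>: "finite \<F>" "\<F> \<subseteq> W ` ?N" "?N \<subseteq> \<Union>\<F>"
    by (elim exE conjE)
  obtain Z where Z: "Z \<subseteq> ?N" "finite Z" "\<F> = W ` Z"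
    using finite_subset_image[OF \<F>(1,2)] by (elim exE conjE)
  have "\<forall>z\<in>Z. \<exists>Rz. forces_trivial F Rz \<and> z \<otimes> inv a \<in> solution_set G Rz"
  proof
    fix z assume "z \<in> Z"
    then have "z \<otimes> inv a \<in> ?N"
      using Z(1) mult_N aN by auto
    then show "\<exists>Rz. forces_trivial F Rz \<and> z \<otimes> inv a \<in> solution_set G Rz"
      using killed_imp_in_solution_set[OF is_group F(2), of "z \<otimes> inv a"] by (auto simp: N)
  qed
  then obtain Q where Q: "\<And>z. z \<in> Z \<Longrightarrow> forces_trivial F (Q z)"
      "\<And>z. z \<in> Z \<Longrightarrow> z \<otimes> inv a \<in> solution_set G (Q z)"
    by metis
  have "\<exists>S. forces_trivial F S \<and> (\<forall>P\<in>(\<lambda>z. product_relations (Q z) R) ` Z. solution_set G P \<subseteq> solution_set G S)"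
    using Z(2) Q(1) R(1) forces_trivial_product[OF F(1)]
    by (intro solution_sets_directed[OF is_group F(1)]) auto
  then obtain S where S: "forces_trivial F S"
      "\<And>z. z \<in> Z \<Longrightarrow> solution_set G (product_relations (Q z) R) \<subseteq> solution_set G S"
    by auto
  have "?N \<subseteq> solution_set G S"
  proof
    fix x assume "x \<in> ?N"
    then obtain z where z: "z \<in> Z" "x \<in> W z"
      using \<F>(3) Z(3) by auto
    then have zc: "z \<in> carrier G" and x: "x \<in> carrier G" "a \<otimes> inv z \<otimes> x \<in> solution_set G R"
      using Z(1) U(2) by (auto simp: N W_def)
    have "(z \<otimes> inv a) \<otimes> (a \<otimes> inv z \<otimes> x) \<in> solution_set G (product_relations (Q z) R)"
      by (rule mult_in_solution_set_product[OF is_group Q(2)[OF z(1)] x(2)])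
    moreover have "(z \<otimes> inv a) \<otimes> (a \<otimes> inv z \<otimes> x) = x"
    proof -
      have "inv a \<otimes> (a \<otimes> inv z \<otimes> x) = inv z \<otimes> x"
        using zc ac x(1) inv_solve_left'[of a "inv z \<otimes> x"] by (simp add: m_assoc inv_solve_left')
      then have "(z \<otimes> inv a) \<otimes> (a \<otimes> inv z \<otimes> x) = z \<otimes> (inv z \<otimes> x)"
        using zc ac x(1) by (simp add: m_assoc)
      also have "\<dots> = (z \<otimes> inv z) \<otimes> x"
        using zc x(1) by (intro m_assoc[symmetric]) auto
      finally show ?thesis
        using zc x(1) by simp
    qed
    ultimately show "x \<in> solution_set G S"
      using S(2)[OF z(1)] by auto
  qed
  then show ?thesis
    using S(1) sub[OF S(1)] by blast
qed

end

section \<open>First-order formulas\<close>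

definition Exists where "Exists n \<phi> = Neg (All n (Neg \<phi>))"

definition Implies where "Implies \<phi> \<psi> = Neg (Conj \<phi> (Neg \<psi>))"

definition Conjs where "Conjs \<phi>s = foldr Conj \<phi>s (Eq group_term.One group_term.One)"

definition Disjs where "Disjs \<phi>s = Neg (Conjs (map Neg \<phi>s))"

definition All_list where "All_list vs \<phi> = foldr All vs \<phi>"

definition Exists_list where "Exists_list vs \<phi> = foldr Exists vs \<phi>"

lemma holds_Exists: "holds G e (Exists n \<phi>) \<longleftrightarrow> (\<exists>x\<in>carrier G. holds G (e(n := x)) \<phi>)"
  by (simp add: Exists_def)

lemma holds_Implies: "holds G e (Implies \<phi> \<psi>) \<longleftrightarrow> (holds G e \<phi> \<longrightarrow> holds G e \<psi>)"
  by (simp add: Implies_def)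

lemma holds_Conjs: "holds G e (Conjs \<phi>s) \<longleftrightarrow> (\<forall>\<phi>\<in>set \<phi>s. holds G e \<phi>)"
  by (induction \<phi>s) (auto simp: Conjs_def)

lemma holds_Disjs: "holds G e (Disjs \<phi>s) \<longleftrightarrow> (\<exists>\<phi>\<in>set \<phi>s. holds G e \<phi>)"
  by (simp add: Disjs_def holds_Conjs)

text \<open>The assignments that quantification over the block \<open>vs\<close> ranges over, starting from \<open>e\<close>.\<close>

definition reassigns where
  "reassigns G vs e e' \<longleftrightarrow> (\<forall>v. v \<notin> set vs \<longrightarrow> e' v = e v) \<and> (\<forall>v\<in>set vs. e' v \<in> carrier G)"

lemma reassigns_Cons:
  "reassigns G (v # vs) e e' \<longleftrightarrow> e' v \<in> carrier G \<and> reassigns G vs (e(v := e' v)) e'"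
  by (auto simp: reassigns_def)

lemma reassigns_update:
  assumes "x \<in> carrier G" "reassigns G vs (e(v := x)) e'"
  shows "reassigns G (v # vs) e e'"
  using assms by (auto simp: reassigns_def split: if_splits)

lemma holds_Exists_list: "holds G e (Exists_list vs \<phi>) \<longleftrightarrow> (\<exists>e'. reassigns G vs e e' \<and> holds G e' \<phi>)"
proof (induction vs arbitrary: e)
  case Nil
  have "reassigns G [] e e' \<longleftrightarrow> e' = e" for e'
    by (auto simp: reassigns_def)
  then show ?case by (simp add: Exists_list_def)
next
  case (Cons v vs)
  have "Exists_list (v # vs) \<phi> = Exists v (Exists_list vs \<phi>)"
    by (simp add: Exists_list_def)
  then show ?case
    unfolding Cons.IH holds_Exists \<open>Exists_list (v # vs) \<phi> = Exists v (Exists_list vs \<phi>)\<close>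
    by (meson reassigns_Cons reassigns_update)
qed

lemma holds_All_list: "holds G e (All_list vs \<phi>) \<longleftrightarrow> (\<forall>e'. reassigns G vs e e' \<longrightarrow> holds G e' \<phi>)"
proof -
  have "holds G e (All_list vs \<phi>) \<longleftrightarrow> \<not> holds G e (Exists_list vs (Neg \<phi>))" for e
    by (induction vs arbitrary: e) (auto simp: All_list_def Exists_list_def holds_Exists)
  then show ?thesis
    by (simp add: holds_Exists_list)
qed

lemma term_value_cong:
  "(\<And>v. v \<in> term_vars t \<Longrightarrow> e v = e' v) \<Longrightarrow> term_value G e t = term_value G e' t"
  by (induction t) auto

lemma finite_free_vars: "finite (free_vars \<phi>)"
proof -
  have "finite (term_vars t)" for t
    by (induction t) auto
  then show ?thesis
    by (induction \<phi>) auto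
qed

lemma free_vars_All_list: "free_vars (All_list vs \<phi>) = free_vars \<phi> - set vs"
  by (induction vs) (auto simp: All_list_def)

text \<open>Elementary equivalence concerns sentences only. A formula that holds in \<open>G\<close> under all assignments
  is transferred by way of its universal closure.\<close>

lemma elementarily_equivalent_transfer:
  assumes eq: "elementarily_equivalent G H"
    and G: "\<And>e. range e \<subseteq> carrier G \<Longrightarrow> holds G e \<phi>"
    and e: "range e \<subseteq> carrier H"
  shows "holds H e \<phi>"
proof -
  obtain vs where vs: "set vs = free_vars \<phi>"
    using finite_list[OF finite_free_vars[of \<phi>]] ..
  have "sentence (All_list vs \<phi>)"
    by (simp add: sentence_def free_vars_All_list vs)
  moreover have "satisfies G (All_list vs \<phi>)"
    unfolding satisfies_def holds_All_list
  proof (intro allI impI G)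
    fix e e' assume e: "range e \<subseteq> carrier G" "reassigns G vs e e'"
    have "e' v \<in> carrier G" for v
      using e by (cases "v \<in> set vs") (auto simp: reassigns_def)
    then show "range e' \<subseteq> carrier G"
      by auto
  qed
  ultimately have "holds H e (All_list vs \<phi>)"
    using eq e by (simp add: elementarily_equivalent_def satisfies_def)
  moreover have "reassigns H vs e e"
    using e by (auto simp: reassigns_def)
  ultimately show ?thesis
    by (simp add: holds_All_list)
qed

text \<open>The variables below \<open>r\<close> are reserved for the unknowns of the system, which are bound by the
  formula; for the intended meaning \<open>t\<close> must only use variables from \<open>r\<close> on.\<close>

definition solution_formula where
  "solution_formula R r t = Exists_list [0..<r] (Conj (Eq (Var 0) t)
     (Conjs (map (\<lambda>(i, j, k). Eq (Mult (Var i) (Var j)) (Var k)) R)))"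

lemma holds_solution_formula:
  assumes e: "range e \<subseteq> carrier G" and r: "0 < r"
    and R: "\<And>i j k. (i, j, k) \<in> set R \<Longrightarrow> i < r \<and> j < r \<and> k < r"
    and t: "\<And>v. v \<in> term_vars t \<Longrightarrow> r \<le> v"
  shows "holds G e (solution_formula R r t) \<longleftrightarrow> term_value G e t \<in> solution_set G R"
proof
  assume "holds G e (solution_formula R r t)"
  then obtain e' where e': "reassigns G [0..<r] e e'" "e' 0 = term_value G e' t"
    and eqs: "\<forall>(i, j, k)\<in>set R. e' i \<otimes>\<^bsub>G\<^esub> e' j = e' k"
    by (auto simp: solution_formula_def holds_Exists_list holds_Conjs split_beta)
  have "e' v \<in> carrier G" for v
    using e e'(1) by (cases "v < r") (auto simp: reassigns_def)
  then have "solves G R e'"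
    using eqs by (auto simp: solves_def)
  moreover have "term_value G e' t = term_value G e t"
    using e'(1) t by (intro term_value_cong) (auto simp: reassigns_def leD)
  ultimately show "term_value G e t \<in> solution_set G R"
    using e'(2) unfolding solution_set_def by (intro CollectI exI[of _ e']) simp
next
  assume "term_value G e t \<in> solution_set G R"
  then obtain y where y: "solves G R y" "y 0 = term_value G e t"
    by (auto simp: solution_set_def)
  define e' where "e' v = (if v < r then y v else e v)" for v
  have "reassigns G [0..<r] e e'"
    using y(1) by (auto simp: reassigns_def e'_def solves_def)
  moreover have "term_value G e' t = term_value G e t"
    using t by (intro term_value_cong) (auto simp: e'_def leD)
  then have "e' 0 = term_value G e' t"
    using y(2) r by (simp add: e'_def)
  moreover have "e' i \<otimes>\<^bsub>G\<^esub> e' j = e' k" if "(i, j, k) \<in> set R" for i j k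
    using y(1) R[OF that] that by (auto simp: solves_def e'_def)
  ultimately show "holds G e (solution_formula R r t)"
    unfolding solution_formula_def holds_Exists_list
    by (intro exI[of _ e'] conjI) (auto simp: holds_Conjs)
qed

section \<open>Transfer of the finite quotient structure\<close>

text \<open>A first-order substitute for the statement that \<open>G / N\<close> is a group on \<open>{..<m}\<close> with multiplication
  table \<open>\<tau>\<close>. All three clauses are put under the same two quantifiers, so that for a solution set
  \<open>N\<close> the formula below expresses them directly.\<close>

definition coset_system where
  "coset_system G N (m::nat) \<tau> g \<longleftrightarrow> (\<forall>i<m. g i \<in> carrier G) \<and>
     (\<forall>x\<in>carrier G. \<forall>y\<in>carrier G.
        (\<exists>i<m. inv\<^bsub>G\<^esub> (g i) \<otimes>\<^bsub>G\<^esub> x \<in> N) \<and>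
        (\<forall>i<m. \<forall>j<m. i \<noteq> j \<longrightarrow> \<not> (inv\<^bsub>G\<^esub> (g i) \<otimes>\<^bsub>G\<^esub> x \<in> N \<and> inv\<^bsub>G\<^esub> (g j) \<otimes>\<^bsub>G\<^esub> x \<in> N)) \<and>
        (\<forall>i<m. \<forall>j<m. inv\<^bsub>G\<^esub> (g i) \<otimes>\<^bsub>G\<^esub> x \<in> N \<and> inv\<^bsub>G\<^esub> (g j) \<otimes>\<^bsub>G\<^esub> y \<in> N \<longrightarrow>
           inv\<^bsub>G\<^esub> (g (\<tau> i j)) \<otimes>\<^bsub>G\<^esub> (x \<otimes>\<^bsub>G\<^esub> y) \<in> N))"

lemma coset_system_cong:
  assumes g: "coset_system G N m \<tau> g" and \<tau>: "\<And>i j. i < m \<Longrightarrow> j < m \<Longrightarrow> \<tau> i j < m"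
    and g': "\<And>i. i < m \<Longrightarrow> g' i = g i"
  shows "coset_system G N m \<tau> g'"
proof -
  define P where "P i z \<longleftrightarrow> inv\<^bsub>G\<^esub> (g i) \<otimes>\<^bsub>G\<^esub> z \<in> N" for i z
  define P' where "P' i z \<longleftrightarrow> inv\<^bsub>G\<^esub> (g' i) \<otimes>\<^bsub>G\<^esub> z \<in> N" for i z
  have eq: "P' i z \<longleftrightarrow> P i z" if "i < m" for i z
    using g'[OF that] by (simp add: P_def P'_def)
  note g = g[unfolded coset_system_def P_def[symmetric]]
  have 1: "\<forall>i<m. g' i \<in> carrier G"
    using g g' by simp
  have 2: "\<exists>i<m. P' i x" if "x \<in> carrier G" for x
  proof -
    have "\<exists>i<m. P i x" using g that by blast
    then show ?thesis using eq by blast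
  qed
  have 3: "\<not> (P' i x \<and> P' j x)" if "x \<in> carrier G" "i < m" "j < m" "i \<noteq> j" for x i j
  proof -
    have "\<not> (P i x \<and> P j x)" using g that by blast
    then show ?thesis using eq that by blast
  qed
  have 4: "P' (\<tau> i j) (x \<otimes>\<^bsub>G\<^esub> y)"
    if "x \<in> carrier G" "y \<in> carrier G" "i < m" "j < m" "P' i x \<and> P' j y" for x y i j
  proof -
    have "P i x \<and> P j y" using eq that by blast
    then have "P (\<tau> i j) (x \<otimes>\<^bsub>G\<^esub> y)" using g that by blast
    then show ?thesis using eq[OF \<tau>[OF that(3,4)]] by blast
  qed
  show ?thesis
    unfolding coset_system_def P'_def[symmetric]
    using 1 2 3 4 by (intro conjI ballI allI impI) blast+
qed

text \<open>The variables \<open>r, \<dots>, r + m - 1\<close> name the coset representatives, and the next two name the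
  elements \<open>x\<close> and \<open>y\<close> of \<open>coset_system\<close>.\<close>

definition coset_formula where
  "coset_formula R r m \<tau> =
     (let x = Var (r + m); y = Var (r + m + 1);
          C = (\<lambda>i t. solution_formula R r (Mult (Inv (Var (r + i))) t));
          ps = List.product [0..<m] [0..<m]
      in Exists_list [r..<r + m] (All (r + m) (All (r + m + 1)
        (Conj (Disjs (map (\<lambda>i. C i x) [0..<m]))
        (Conj (Conjs (map (\<lambda>(i, j). Neg (Conj (C i x) (C j x))) (filter (\<lambda>(i, j). i \<noteq> j) ps)))
              (Conjs (map (\<lambda>(i, j). Implies (Conj (C i x) (C j y)) (C (\<tau> i j) (Mult x y))) ps)))))))"

lemma holds_coset_formula:
  assumes e: "range e \<subseteq> carrier G" and r: "0 < r"
    and R: "\<And>i j k. (i, j, k) \<in> set R \<Longrightarrow> i < r \<and> j < r \<and> k < r"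
    and \<tau>: "\<And>i j. i < m \<Longrightarrow> j < m \<Longrightarrow> \<tau> i j < m"
  shows "holds G e (coset_formula R r m \<tau>) \<longleftrightarrow> (\<exists>g. coset_system G (solution_set G R) m \<tau> g)"
proof -
  define C where "C i t = solution_formula R r (Mult (Inv (Var (r + i))) t)" for i t
  define \<beta> where "\<beta> = Conj (Disjs (map (\<lambda>i. C i (Var (r + m))) [0..<m]))
        (Conj (Conjs (map (\<lambda>(i, j). Neg (Conj (C i (Var (r + m))) (C j (Var (r + m)))))
                 (filter (\<lambda>(i, j). i \<noteq> j) (List.product [0..<m] [0..<m]))))
              (Conjs (map (\<lambda>(i, j). Implies (Conj (C i (Var (r + m))) (C j (Var (r + m + 1))))
                   (C (\<tau> i j) (Mult (Var (r + m)) (Var (r + m + 1)))))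
                 (List.product [0..<m] [0..<m]))))"
  have formula: "coset_formula R r m \<tau> = Exists_list [r..<r + m] (All (r + m) (All (r + m + 1) \<beta>))"
    unfolding coset_formula_def \<beta>_def C_def Let_def by simp
  have matrix: "holds G e' (All (r + m) (All (r + m + 1) \<beta>)) \<and> (\<forall>i<m. e' (r + i) \<in> carrier G) \<longleftrightarrow>
      coset_system G (solution_set G R) m \<tau> (\<lambda>i. e' (r + i))" if e': "range e' \<subseteq> carrier G" for e'
  proof -
    have C: "holds G (e'(r + m := x, r + m + 1 := y)) (C i t) \<longleftrightarrow>
        inv\<^bsub>G\<^esub> (e' (r + i)) \<otimes>\<^bsub>G\<^esub> term_value G (e'(r + m := x, r + m + 1 := y)) t \<in> solution_set G R"
      if "i < m" "x \<in> carrier G" "y \<in> carrier G" "\<And>v. v \<in> term_vars t \<Longrightarrow> r \<le> v" for i t x y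
    proof -
      have "range (e'(r + m := x, r + m + 1 := y)) \<subseteq> carrier G"
        using e' that by auto
      then show ?thesis
        unfolding C_def using r R that by (subst holds_solution_formula) auto
    qed
    have "holds G (e'(r + m := x, r + m + 1 := y)) \<beta> \<longleftrightarrow>
        (\<exists>i<m. inv\<^bsub>G\<^esub> (e' (r + i)) \<otimes>\<^bsub>G\<^esub> x \<in> solution_set G R) \<and>
        (\<forall>i<m. \<forall>j<m. i \<noteq> j \<longrightarrow> \<not> (inv\<^bsub>G\<^esub> (e' (r + i)) \<otimes>\<^bsub>G\<^esub> x \<in> solution_set G R \<and>
            inv\<^bsub>G\<^esub> (e' (r + j)) \<otimes>\<^bsub>G\<^esub> x \<in> solution_set G R)) \<and>
        (\<forall>i<m. \<forall>j<m. inv\<^bsub>G\<^esub> (e' (r + i)) \<otimes>\<^bsub>G\<^esub> x \<in> solution_set G R \<and>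
            inv\<^bsub>G\<^esub> (e' (r + j)) \<otimes>\<^bsub>G\<^esub> y \<in> solution_set G R \<longrightarrow>
            inv\<^bsub>G\<^esub> (e' (r + \<tau> i j)) \<otimes>\<^bsub>G\<^esub> (x \<otimes>\<^bsub>G\<^esub> y) \<in> solution_set G R)"
      if xy: "x \<in> carrier G" "y \<in> carrier G" for x y
    proof -
      have Cx: "holds G (e'(r + m := x, r + m + 1 := y)) (C i (Var (r + m))) \<longleftrightarrow>
          inv\<^bsub>G\<^esub> (e' (r + i)) \<otimes>\<^bsub>G\<^esub> x \<in> solution_set G R" if "i < m" for i
        using C[OF that xy, of "Var (r + m)"] by simp
      have Cy: "holds G (e'(r + m := x, r + m + 1 := y)) (C i (Var (r + m + 1))) \<longleftrightarrow>
          inv\<^bsub>G\<^esub> (e' (r + i)) \<otimes>\<^bsub>G\<^esub> y \<in> solution_set G R" if "i < m" for i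
        using C[OF that xy, of "Var (r + m + 1)"] by simp
      have Cxy: "holds G (e'(r + m := x, r + m + 1 := y)) (C i (Mult (Var (r + m)) (Var (r + m + 1)))) \<longleftrightarrow>
          inv\<^bsub>G\<^esub> (e' (r + i)) \<otimes>\<^bsub>G\<^esub> (x \<otimes>\<^bsub>G\<^esub> y) \<in> solution_set G R" if i: "i < m" for i
        by (subst C[OF i xy]) auto
      define E where "E = e'(r + m := x, r + m + 1 := y)"
      note Cs = Cx[folded E_def] Cy[folded E_def] Cxy[folded E_def]
      show ?thesis
        unfolding E_def[symmetric] \<beta>_def
        using \<tau> by (auto simp: holds_Conjs holds_Disjs holds_Implies Cs simp del: One_nat_def add_Suc_right)
    qed
    then show ?thesis
      unfolding coset_system_def holds.simps by auto
  qed
  show ?thesis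
  proof
    assume "holds G e (coset_formula R r m \<tau>)"
    then obtain e' where e': "reassigns G [r..<r + m] e e'" "holds G e' (All (r + m) (All (r + m + 1) \<beta>))"
      unfolding formula holds_Exists_list by blast
    have "e' v \<in> carrier G" for v
      using e e'(1) by (cases "v \<in> set [r..<r + m]") (auto simp: reassigns_def)
    then show "\<exists>g. coset_system G (solution_set G R) m \<tau> g"
      using matrix[of e'] e'(2) by (metis image_subset_iff)
  next
    assume "\<exists>g. coset_system G (solution_set G R) m \<tau> g"
    then obtain g where g: "coset_system G (solution_set G R) m \<tau> g" by blast
    define e' where "e' v = (if r \<le> v \<and> v < r + m then g (v - r) else e v)" for v
    have "g i \<in> carrier G" if "i < m" for i
      using g that by (simp add: coset_system_def)
    then have e': "e' v \<in> carrier G" for v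
      using e by (auto simp: e'_def)
    then have "reassigns G [r..<r + m] e e'"
      by (auto simp: reassigns_def) (auto simp: e'_def)
    moreover have "coset_system G (solution_set G R) m \<tau> (\<lambda>i. e' (r + i))"
      by (rule coset_system_cong[OF g \<tau>]) (simp_all add: e'_def)
    ultimately show "holds G e (coset_formula R r m \<tau>)"
      unfolding formula holds_Exists_list using matrix[of e'] e' by (metis image_subset_iff)
  qed
qed

lemma coset_system_elementarily_equivalent:
  assumes "elementarily_equivalent G H" and "group H"
    and \<tau>: "\<And>i j. i < m \<Longrightarrow> j < m \<Longrightarrow> \<tau> i j < m"
    and g: "coset_system G (solution_set G R) m \<tau> g"
  shows "\<exists>h. coset_system H (solution_set H R) m \<tau> h"
proof -
  interpret H: group H by fact
  \<comment> \<open>A bound that exceeds all variables occurring in \<open>R\<close>.\<close>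
  define r where "r = Suc (sum_list (map (\<lambda>(i, j, k). i + j + k) R))"
  have R: "i < r \<and> j < r \<and> k < r" if ijk: "(i, j, k) \<in> set R" for i j k
  proof -
    have "i + j + k \<in> set (map (\<lambda>(i, j, k). i + j + k) R)"
      using imageI[OF ijk, of "\<lambda>(i, j, k). i + j + k"] by simp
    from member_le_sum_list[OF this] show ?thesis
      by (simp add: r_def)
  qed
  have r: "0 < r" by (simp add: r_def)
  have "holds H (\<lambda>_. \<one>\<^bsub>H\<^esub>) (coset_formula R r m \<tau>)"
  proof (rule elementarily_equivalent_transfer[OF assms(1)])
    show "holds G e (coset_formula R r m \<tau>)" if "range e \<subseteq> carrier G" for e
      using holds_coset_formula[where R=R and r=r and m=m and \<tau>=\<tau>, OF that r R \<tau>] g by blast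
  qed auto
  then show ?thesis
    using holds_coset_formula[of "\<lambda>_. \<one>\<^bsub>H\<^esub>" H r R m \<tau>, OF _ r R \<tau>] by auto
qed

text \<open>Here \<open>idx\<close> is the projection onto the finite quotient, realised as \<open>{..<m}\<close> with
  multiplication \<open>\<tau>\<close>, and \<open>g\<close> is a section of it. Two groups that are indexed by the same table
  have isomorphic quotients.\<close>

definition indexes_cosets where
  "indexes_cosets G F m \<tau> g idx \<longleftrightarrow>
     (\<forall>i<m. g i \<in> carrier G \<and> idx (g i) = i) \<and>
     (\<forall>x\<in>carrier G. idx x < m \<and> (\<forall>\<phi>\<in>hom G F. \<phi> (g (idx x)) = \<phi> x)) \<and>
     (\<forall>x\<in>carrier G. \<forall>y\<in>carrier G. idx (x \<otimes>\<^bsub>G\<^esub> y) = \<tau> (idx x) (idx y))"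

lemma coset_system_index:
  assumes "group G" "group F" and sys: "coset_system G N m \<tau> g" and "\<one>\<^bsub>G\<^esub> \<in> N"
    and \<tau>: "\<And>i j. i < m \<Longrightarrow> j < m \<Longrightarrow> \<tau> i j < m"
    and kill: "\<And>x \<phi>. x \<in> N \<Longrightarrow> \<phi> \<in> hom G F \<Longrightarrow> \<phi> x = \<one>\<^bsub>F\<^esub>"
  shows "\<exists>idx. indexes_cosets G F m \<tau> g idx"
proof -
  interpret G: group G by fact
  have g: "g i \<in> carrier G" if "i < m" for i
    using sys that by (simp add: coset_system_def)
  have ex: "\<exists>i<m. inv\<^bsub>G\<^esub> (g i) \<otimes>\<^bsub>G\<^esub> x \<in> N" if "x \<in> carrier G" for x
    using sys that by (auto simp: coset_system_def)
  have uniq: "i = j" if "x \<in> carrier G" "i < m" "j < m" "inv\<^bsub>G\<^esub> (g i) \<otimes>\<^bsub>G\<^esub> x \<in> N"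
      "inv\<^bsub>G\<^esub> (g j) \<otimes>\<^bsub>G\<^esub> x \<in> N" for x i j
    using sys that unfolding coset_system_def by metis
  have mult: "inv\<^bsub>G\<^esub> (g (\<tau> i j)) \<otimes>\<^bsub>G\<^esub> (x \<otimes>\<^bsub>G\<^esub> y) \<in> N"
    if "x \<in> carrier G" "y \<in> carrier G" "i < m" "j < m" "inv\<^bsub>G\<^esub> (g i) \<otimes>\<^bsub>G\<^esub> x \<in> N"
      "inv\<^bsub>G\<^esub> (g j) \<otimes>\<^bsub>G\<^esub> y \<in> N" for x y i j
    using sys that unfolding coset_system_def by metis
  define idx where "idx x = (SOME i. i < m \<and> inv\<^bsub>G\<^esub> (g i) \<otimes>\<^bsub>G\<^esub> x \<in> N)" for x
  have idx: "idx x < m" "inv\<^bsub>G\<^esub> (g (idx x)) \<otimes>\<^bsub>G\<^esub> x \<in> N" if "x \<in> carrier G" for x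
    using someI_ex[OF ex[OF that]] by (auto simp: idx_def)
  have "idx (g i) = i" if "i < m" for i
    using uniq[OF g[OF that] idx(1)[OF g[OF that]] that idx(2)[OF g[OF that]]] g[OF that] \<open>\<one>\<^bsub>G\<^esub> \<in> N\<close>
    by simp
  moreover have "\<phi> (g (idx x)) = \<phi> x" if x: "x \<in> carrier G" and \<phi>: "\<phi> \<in> hom G F" for x \<phi>
    using hom_eq_iff_quotient[OF assms(1,2) \<phi> x g[OF idx(1)[OF x]]] kill[OF idx(2)[OF x] \<phi>] by simp
  moreover have "idx (x \<otimes>\<^bsub>G\<^esub> y) = \<tau> (idx x) (idx y)" if xy: "x \<in> carrier G" "y \<in> carrier G" for x y
    using mult[OF xy idx(1)[OF xy(1)] idx(1)[OF xy(2)] idx(2)[OF xy(1)] idx(2)[OF xy(2)]] xy idx \<tau>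
    by (intro uniq[of "x \<otimes>\<^bsub>G\<^esub> y"]) auto
  ultimately show ?thesis
    unfolding indexes_cosets_def using g idx(1) by (intro exI[of _ idx]) auto
qed

text \<open>A map that sends \<open>x\<close> to the representative in the other group with the same index looks like a
  homomorphism to every \<open>\<psi>\<close> in \<open>hom H F\<close>, since \<open>\<psi>\<close> depends on the index only and indices are
  multiplied by the same table on both sides.\<close>

lemma indexed_hom_compose:
  assumes "group G" "group H"
    and G: "indexes_cosets G F m \<tau> g idx" and H: "indexes_cosets H F m \<tau> h idx'"
    and \<psi>: "\<psi> \<in> hom H F"
  shows "(\<lambda>x. \<psi> (h (idx x))) \<in> hom G F"
    and "y \<in> carrier H \<Longrightarrow> \<psi> (h (idx (g (idx' y)))) = \<psi> y"
proof -
  have h: "h i \<in> carrier H" "idx' (h i) = i" if "i < m" for i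
    using H that by (auto simp: indexes_cosets_def)
  have idx: "idx x < m" if "x \<in> carrier G" for x
    using G that by (auto simp: indexes_cosets_def)
  interpret H: group H by fact
  show "(\<lambda>x. \<psi> (h (idx x))) \<in> hom G F"
  proof (rule homI)
    show "\<psi> (h (idx x)) \<in> carrier F" if "x \<in> carrier G" for x
      using hom_in_carrier[OF \<psi> h(1)[OF idx[OF that]]] .
    fix x y assume xy: "x \<in> carrier G" "y \<in> carrier G"
    let ?a = "h (idx x)" and ?b = "h (idx y)"
    have ab: "?a \<in> carrier H" "?b \<in> carrier H"
      using h(1) idx xy by auto
    have "idx (x \<otimes>\<^bsub>G\<^esub> y) = \<tau> (idx x) (idx y)"
      using G xy by (simp add: indexes_cosets_def)
    also have "\<dots> = \<tau> (idx' ?a) (idx' ?b)"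
      using h(2) idx xy by simp
    also have "\<dots> = idx' (?a \<otimes>\<^bsub>H\<^esub> ?b)"
      using H ab by (simp add: indexes_cosets_def)
    finally have "idx (x \<otimes>\<^bsub>G\<^esub> y) = idx' (?a \<otimes>\<^bsub>H\<^esub> ?b)" .
    moreover have "\<psi> (h (idx' z)) = \<psi> z" if "z \<in> carrier H" for z
      using H \<psi> that unfolding indexes_cosets_def by blast
    ultimately have "\<psi> (h (idx (x \<otimes>\<^bsub>G\<^esub> y))) = \<psi> (?a \<otimes>\<^bsub>H\<^esub> ?b)"
      using ab by (metis H.m_closed)
    then show "\<psi> (h (idx (x \<otimes>\<^bsub>G\<^esub> y))) = \<psi> ?a \<otimes>\<^bsub>F\<^esub> \<psi> ?b"
      using hom_mult[OF \<psi> ab] by simp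
  qed
  show "\<psi> (h (idx (g (idx' y)))) = \<psi> y" if "y \<in> carrier H"
    using G H that \<psi> by (simp add: indexes_cosets_def)
qed

text \<open>Such maps are not homomorphisms in general, but they induce mutually inverse isomorphisms between
  the quotients of \<open>G\<close> and \<open>H\<close> by the common kernels of the homomorphisms into \<open>F\<close>.\<close>

definition inverse_modulo_homs where
  "inverse_modulo_homs G H F f h \<longleftrightarrow>
     (\<forall>\<psi>\<in>hom H F. \<psi> \<circ> f \<in> hom G F) \<and> (\<forall>\<phi>\<in>hom G F. \<phi> \<circ> h \<in> hom H F) \<and>
     (\<forall>\<psi>\<in>hom H F. \<forall>y\<in>carrier H. \<psi> (f (h y)) = \<psi> y) \<and>
     (\<forall>\<phi>\<in>hom G F. \<forall>x\<in>carrier G. \<phi> (h (f x)) = \<phi> x)"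

context compact_group
begin

lemma hom_class_representatives:
  assumes opn: "\<And>d. d \<in> carrier G \<Longrightarrow> openin T (hom_class G F d)"
  shows "\<exists>m g. (\<forall>i<(m::nat). g i \<in> carrier G) \<and> (\<forall>x\<in>carrier G. \<exists>!i. i < m \<and> x \<in> hom_class G F (g i))"
proof -
  let ?U = "hom_class G F ` carrier G"
  have eq: "x \<in> hom_class G F d \<longleftrightarrow> hom_class G F x = hom_class G F d" if "x \<in> carrier G" "d \<in> carrier G" for x d
    using that by (auto simp: hom_class_def)
  have "finite ?U"
  proof (rule finite_open_partition[OF compact])
    show "\<Union>?U = topspace T"
      by (auto simp: hom_class_def)
    have "hom_class G F d = hom_class G F d'"
      if "d \<in> carrier G" "d' \<in> carrier G" "x \<in> hom_class G F d" "x \<in> hom_class G F d'" for x d d'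
      using that eq[of x d] eq[of x d'] by (simp add: hom_class_def)
    then show "pairwise disjnt ?U"
      unfolding pairwise_def disjnt_iff by blast
  qed (use opn in \<open>auto simp: hom_class_def\<close>)
  then obtain c where c: "bij_betw c {0..<card ?U} ?U"
    using ex_bij_betw_nat_finite by blast
  define g where "g i = (SOME d. d \<in> carrier G \<and> hom_class G F d = c i)" for i
  have g: "g i \<in> carrier G" "hom_class G F (g i) = c i" if "i < card ?U" for i
  proof -
    have "c i \<in> ?U"
      using bij_betwE[OF c] that by simp
    then have "\<exists>d. d \<in> carrier G \<and> hom_class G F d = c i"
      by auto
    from someI_ex[OF this] show "g i \<in> carrier G" "hom_class G F (g i) = c i"
      by (auto simp: g_def)
  qed
  have "\<exists>!i. i < card ?U \<and> x \<in> hom_class G F (g i)" if x: "x \<in> carrier G" for x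
  proof -
    have mem: "x \<in> hom_class G F (g i) \<longleftrightarrow> c i = hom_class G F x" if "i < card ?U" for i
      using eq[OF x g(1)[OF that]] g(2)[OF that] by auto
    have "hom_class G F x \<in> c ` {0..<card ?U}"
      unfolding bij_betw_imp_surj_on[OF c] using x by (rule imageI)
    then obtain i where i: "i < card ?U" "c i = hom_class G F x"
      by (elim imageE) simp
    show ?thesis
    proof (rule ex1I)
      show "i < card ?U \<and> x \<in> hom_class G F (g i)"
        using i mem by simp
      fix j assume j: "j < card ?U \<and> x \<in> hom_class G F (g j)"
      then have "j < card ?U" "c j = c i"
        using mem[OF conjunct1[OF j]] i(2) by auto
      then show "j = i"
        using inj_onD[OF bij_betw_imp_inj_on[OF c]] i(1) by simp
    qed
  qed
  then show ?thesis
    using g(1) by (intro exI[of _ "card ?U"] exI[of _ g]) simp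
qed

lemma coset_system_of_hom_classes:
  assumes F: "group F" and opn: "\<And>d. d \<in> carrier G \<Longrightarrow> openin T (hom_class G F d)"
  shows "\<exists>m \<tau> g. (\<forall>i<m. \<forall>j<m. \<tau> i j < m) \<and> coset_system G (hom_class G F \<one>) m \<tau> g"
proof -
  obtain m :: nat and g where g: "\<And>i. i < m \<Longrightarrow> g i \<in> carrier G"
    and ex1: "\<And>x. x \<in> carrier G \<Longrightarrow> \<exists>!i. i < m \<and> x \<in> hom_class G F (g i)"
    using hom_class_representatives[OF opn] by metis
  have N: "inv (g i) \<otimes> x \<in> hom_class G F \<one> \<longleftrightarrow> x \<in> hom_class G F (g i)"
    if "i < m" "x \<in> carrier G" for i x
    using that g[OF that(1)] hom_eq_iff_quotient[OF is_group F] hom_one[OF _ is_group F]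
    by (auto simp: hom_class_def)
  define \<tau> where "\<tau> i j = (THE k. k < m \<and> g i \<otimes> g j \<in> hom_class G F (g k))" for i j
  have \<tau>: "\<tau> i j < m" "g i \<otimes> g j \<in> hom_class G F (g (\<tau> i j))" if "i < m" "j < m" for i j
    using theI'[OF ex1[of "g i \<otimes> g j"]] g that by (auto simp: \<tau>_def)
  have mult: "x \<otimes> y \<in> hom_class G F (g (\<tau> i j))"
    if "i < m" "j < m" "x \<in> hom_class G F (g i)" "y \<in> hom_class G F (g j)" for i j x y
  proof -
    have c: "x \<in> carrier G" "y \<in> carrier G" "g i \<in> carrier G" "g j \<in> carrier G"
      using that g by (simp_all add: hom_class_def)
    have "\<phi> (x \<otimes> y) = \<phi> (g (\<tau> i j))" if \<phi>: "\<phi> \<in> hom G F" for \<phi>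
    proof -
      have "\<phi> x = \<phi> (g i)" "\<phi> y = \<phi> (g j)" "\<phi> (g i \<otimes> g j) = \<phi> (g (\<tau> i j))"
        using \<phi> \<open>x \<in> hom_class G F (g i)\<close> \<open>y \<in> hom_class G F (g j)\<close> \<tau>(2)[OF \<open>i < m\<close> \<open>j < m\<close>]
        unfolding hom_class_def by blast+
      then show ?thesis
        using hom_mult[OF \<phi> c(1,2)] hom_mult[OF \<phi> c(3,4)] by metis
    qed
    then show ?thesis
      using c by (simp add: hom_class_def)
  qed
  have "coset_system G (hom_class G F \<one>) m \<tau> g"
    unfolding coset_system_def
  proof (intro conjI ballI allI impI)
    fix x y assume xy: "x \<in> carrier G" "y \<in> carrier G"
    show "\<exists>i<m. inv (g i) \<otimes> x \<in> hom_class G F \<one>"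
      using ex1[OF xy(1)] N xy(1) by blast
    fix i j assume ij: "i < m" "j < m"
    show "\<not> (inv (g i) \<otimes> x \<in> hom_class G F \<one> \<and> inv (g j) \<otimes> x \<in> hom_class G F \<one>)" if "i \<noteq> j"
      using ex1[OF xy(1)] N[OF ij(1) xy(1)] N[OF ij(2) xy(1)] ij that by blast
    show "inv (g (\<tau> i j)) \<otimes> (x \<otimes> y) \<in> hom_class G F \<one>"
      if "inv (g i) \<otimes> x \<in> hom_class G F \<one> \<and> inv (g j) \<otimes> y \<in> hom_class G F \<one>"
      using that mult[OF ij] N[OF ij(1) xy(1)] N[OF ij(2) xy(2)] N[OF \<tau>(1)[OF ij]] xy by simp
  qed (use g in simp)
  then show ?thesis
    using \<tau>(1) by blast
qed

text \<open>Finitely many disjoint closed cosets cover the group, so each of them is open. Homomorphisms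
  into \<open>F\<close> are constant on these cosets.\<close>

lemma openin_hom_class_of_coset_system:
  assumes F: "group F" and sys: "coset_system G N m \<tau> g" and N: "closedin T N"
    and kill: "\<And>x \<phi>. x \<in> N \<Longrightarrow> \<phi> \<in> hom G F \<Longrightarrow> \<phi> x = \<one>\<^bsub>F\<^esub>"
  shows "openin T (hom_class G F d)"
proof -
  have g: "g i \<in> carrier G" if "i < m" for i
    using sys that by (simp add: coset_system_def)
  define P where "P i = {x \<in> carrier G. inv (g i) \<otimes> x \<in> N}" for i
  have closed: "closedin T (P i)" if "i < m" for i
    using closedin_continuous_map_preimage[OF continuous_map_translate[of "inv (g i)"] N] g[OF that]
    by (simp add: P_def)
  have cover: "\<exists>i<m. x \<in> P i" if "x \<in> carrier G" for x
    using sys that by (auto simp: coset_system_def P_def)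
  have disj: "i = j" if "x \<in> P i" "x \<in> P j" "i < m" "j < m" for x i j
    using sys that unfolding coset_system_def P_def by blast
  have opn: "openin T (P i)" if i: "i < m" for i
  proof -
    have "topspace T - P i = (\<Union>j\<in>{..<m} - {i}. P j)"
    proof (intro equalityI subsetI)
      fix x assume x: "x \<in> topspace T - P i"
      then obtain j where "j < m" "x \<in> P j"
        using cover[of x] by auto
      then show "x \<in> (\<Union>j\<in>{..<m} - {i}. P j)"
        using x by auto
    next
      fix x assume "x \<in> (\<Union>j\<in>{..<m} - {i}. P j)"
      then obtain j where j: "j < m" "j \<noteq> i" "x \<in> P j" by auto
      then have "x \<notin> P i"
        using disj[of x i j] i by auto
      then show "x \<in> topspace T - P i"
        using j(3) by (simp add: P_def)
    qed
    moreover have "closedin T (\<Union>j\<in>{..<m} - {i}. P j)"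
      using closed by (intro closedin_Union) auto
    ultimately show ?thesis
      using openin_closedin_eq[of T "P i"] by (auto simp: P_def)
  qed
  have P: "\<phi> x = \<phi> (g i)" if "x \<in> P i" "i < m" "\<phi> \<in> hom G F" for x i \<phi>
    using that kill hom_eq_iff_quotient[OF is_group F that(3) _ g[OF that(2)], of x] by (auto simp: P_def)
  have "hom_class G F d = (\<Union>i\<in>{i. i < m \<and> g i \<in> hom_class G F d}. P i)"
  proof
    show "hom_class G F d \<subseteq> (\<Union>i\<in>{i. i < m \<and> g i \<in> hom_class G F d}. P i)"
    proof
      fix x assume x: "x \<in> hom_class G F d"
      then obtain i where i: "i < m" "x \<in> P i"
        using cover[of x] by (auto simp: hom_class_def)
      have "\<phi> (g i) = \<phi> d" if \<phi>: "\<phi> \<in> hom G F" for \<phi>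
      proof -
        have "\<phi> x = \<phi> d"
          using x \<phi> unfolding hom_class_def by blast
        then show ?thesis
          using P[OF i(2,1) \<phi>] by metis
      qed
      then have "g i \<in> hom_class G F d"
        using g[OF i(1)] by (simp add: hom_class_def)
      then show "x \<in> (\<Union>i\<in>{i. i < m \<and> g i \<in> hom_class G F d}. P i)"
        using i by auto
    qed
    show "(\<Union>i\<in>{i. i < m \<and> g i \<in> hom_class G F d}. P i) \<subseteq> hom_class G F d"
    proof
      fix x assume "x \<in> (\<Union>i\<in>{i. i < m \<and> g i \<in> hom_class G F d}. P i)"
      then obtain i where i: "i < m" "g i \<in> hom_class G F d" "x \<in> P i" by auto
      have "\<phi> x = \<phi> d" if \<phi>: "\<phi> \<in> hom G F" for \<phi>
      proof -
        have "\<phi> (g i) = \<phi> d"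
          using i(2) \<phi> unfolding hom_class_def by blast
        then show ?thesis
          using P[OF i(3,1) \<phi>] by metis
      qed
      then show "x \<in> hom_class G F d"
        using i(3) by (simp add: hom_class_def P_def)
    qed
  qed
  also have "openin T \<dots>"
    using opn by (intro openin_Union) auto
  finally show ?thesis .
qed

end

text \<open>Openness of the classes is only available in \<open>G\<close> at first, where it follows from strong
  completeness; in \<open>H\<close> it is a consequence of the transferred first-order information, since the
  transferred coset system consists of closed sets.\<close>

lemma elementarily_equivalent_finite_quotients:
  assumes G: "compact_group G T" and H: "compact_group H S" and eq: "elementarily_equivalent G H"
    and F: "group F" "finite (carrier F)"
    and opn: "\<And>d. d \<in> carrier G \<Longrightarrow> openin T (hom_class G F d)"
  shows "\<And>d. openin S (hom_class H F d)"
    and "\<exists>f h. f \<in> carrier G \<rightarrow> carrier H \<and> h \<in> carrier H \<rightarrow> carrier G \<and> inverse_modulo_homs G H F f h"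
proof -
  interpret G: compact_group G T by fact
  interpret H: compact_group H S by fact
  let ?N = "hom_class G F \<one>\<^bsub>G\<^esub>"
  obtain R where R: "forces_trivial F R" "solution_set G R = ?N"
    using G.hom_class_one_eq_solution_set[OF F opn] by blast
  obtain m \<tau> g where \<tau>: "\<And>i j. i < m \<Longrightarrow> j < m \<Longrightarrow> \<tau> i j < m"
    and g: "coset_system G (solution_set G R) m \<tau> g"
    using G.coset_system_of_hom_classes[OF F(1) opn] unfolding R(2) by metis
  obtain h where h: "coset_system H (solution_set H R) m \<tau> h"
    using coset_system_elementarily_equivalent[where \<tau>=\<tau>, OF eq H.is_group \<tau> g] by blast
  show "openin S (hom_class H F d)" for d
    by (rule H.openin_hom_class_of_coset_system[OF F(1) h H.closedin_solution_set])
      (rule solution_set_killed[OF R(1)])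
  obtain idx where idx: "indexes_cosets G F m \<tau> g idx"
    using coset_system_index[where \<tau>=\<tau>, OF G.is_group F(1) g one_in_solution_set[OF G.is_group] \<tau>]
      solution_set_killed[OF R(1)] by metis
  obtain idx' where idx': "indexes_cosets H F m \<tau> h idx'"
    using coset_system_index[where \<tau>=\<tau>, OF H.is_group F(1) h one_in_solution_set[OF H.is_group] \<tau>]
      solution_set_killed[OF R(1)] by metis
  have "(\<lambda>x. h (idx x)) \<in> carrier G \<rightarrow> carrier H" "(\<lambda>y. g (idx' y)) \<in> carrier H \<rightarrow> carrier G"
    using idx idx' by (auto simp: indexes_cosets_def)
  moreover have "inverse_modulo_homs G H F (\<lambda>x. h (idx x)) (\<lambda>y. g (idx' y))"
    unfolding inverse_modulo_homs_def o_def
    using indexed_hom_compose[OF G.is_group H.is_group idx idx']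
      indexed_hom_compose[OF H.is_group G.is_group idx' idx] by blast
  ultimately show "\<exists>f h. f \<in> carrier G \<rightarrow> carrier H \<and> h \<in> carrier H \<rightarrow> carrier G \<and> inverse_modulo_homs G H F f h"
    by blast
qed

section \<open>Gluing approximate isomorphisms\<close>

lemma inverse_modulo_homs_sym:
  "inverse_modulo_homs G H F f h \<Longrightarrow> inverse_modulo_homs H G F h f"
  by (simp add: inverse_modulo_homs_def)

text \<open>If the classes are open, every clause on the right-hand side is a closed condition on the pair
  \<open>(f, h)\<close>. This is not
  evident for \<open>\<psi> (f (h y)) = \<psi> y\<close>, in which \<open>f\<close> is evaluated at a point that depends on \<open>h\<close>; but as
  \<open>\<psi> \<circ> f\<close> is a homomorphism, \<open>h y\<close> may be replaced by any member of its class, and the class of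
  \<open>h y\<close> is locally constant in \<open>h\<close>.\<close>

lemma inverse_modulo_homs_iff:
  assumes "group G" "group H" and f: "f \<in> carrier G \<rightarrow> carrier H" and h: "h \<in> carrier H \<rightarrow> carrier G"
  shows "inverse_modulo_homs G H F f h \<longleftrightarrow>
    (\<forall>\<psi>\<in>hom H F. \<forall>a\<in>carrier G. \<forall>b\<in>carrier G. \<psi> (f (a \<otimes>\<^bsub>G\<^esub> b)) = \<psi> (f a \<otimes>\<^bsub>H\<^esub> f b)) \<and>
    (\<forall>\<phi>\<in>hom G F. \<forall>a\<in>carrier H. \<forall>b\<in>carrier H. \<phi> (h (a \<otimes>\<^bsub>H\<^esub> b)) = \<phi> (h a \<otimes>\<^bsub>G\<^esub> h b)) \<and>
    (\<forall>\<psi>\<in>hom H F. \<forall>y\<in>carrier H. \<forall>d\<in>carrier G. h y \<in> hom_class G F d \<longrightarrow> \<psi> (f d) = \<psi> y) \<and>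
    (\<forall>\<phi>\<in>hom G F. \<forall>x\<in>carrier G. \<forall>d\<in>carrier H. f x \<in> hom_class H F d \<longrightarrow> \<phi> (h d) = \<phi> x)"
    (is "?L \<longleftrightarrow> ?R1 \<and> ?R2 \<and> ?R3 \<and> ?R4")
proof -
  have hom_iff: "(\<forall>\<psi>\<in>hom B F. \<psi> \<circ> k \<in> hom A F) \<longleftrightarrow>
      (\<forall>\<psi>\<in>hom B F. \<forall>a\<in>carrier A. \<forall>b\<in>carrier A. \<psi> (k (a \<otimes>\<^bsub>A\<^esub> b)) = \<psi> (k a \<otimes>\<^bsub>B\<^esub> k b))"
    if k: "k \<in> carrier A \<rightarrow> carrier B"
    for A :: "('x, 'y) monoid_scheme" and B :: "('z, 'w) monoid_scheme" and k
  proof (intro ball_cong refl)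
    fix \<psi> assume \<psi>: "\<psi> \<in> hom B F"
    have "\<psi> (k a \<otimes>\<^bsub>B\<^esub> k b) = \<psi> (k a) \<otimes>\<^bsub>F\<^esub> \<psi> (k b)" if "a \<in> carrier A" "b \<in> carrier A" for a b
      using hom_mult[OF \<psi>, of "k a" "k b"] k that by auto
    moreover have "\<psi> (k a) \<in> carrier F" if "a \<in> carrier A" for a
      using hom_in_carrier[OF \<psi>, of "k a"] k that by auto
    ultimately show "\<psi> \<circ> k \<in> hom A F \<longleftrightarrow>
        (\<forall>a\<in>carrier A. \<forall>b\<in>carrier A. \<psi> (k (a \<otimes>\<^bsub>A\<^esub> b)) = \<psi> (k a \<otimes>\<^bsub>B\<^esub> k b))"
      by (auto simp: hom_def)
  qed
  have section_iff: "(\<forall>\<psi>\<in>hom B F. \<forall>y\<in>carrier B. \<psi> (k (l y)) = \<psi> y) \<longleftrightarrow>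
      (\<forall>\<psi>\<in>hom B F. \<forall>y\<in>carrier B. \<forall>d\<in>carrier A. l y \<in> hom_class A F d \<longrightarrow> \<psi> (k d) = \<psi> y)"
    if k: "\<forall>\<psi>\<in>hom B F. \<psi> \<circ> k \<in> hom A F" and l: "l \<in> carrier B \<rightarrow> carrier A"
    for A :: "('x, 'y) monoid_scheme" and B :: "('z, 'w) monoid_scheme" and k l
  proof (intro ball_cong refl iffI ballI impI)
    fix \<psi> y d assume \<psi>: "\<psi> \<in> hom B F" and y: "\<psi> (k (l y)) = \<psi> y" and d: "l y \<in> hom_class A F d"
    have "(\<psi> \<circ> k) (l y) = (\<psi> \<circ> k) d"
      using k \<psi> d unfolding hom_class_def by blast
    then show "\<psi> (k d) = \<psi> y"
      using y by simp
  next
    fix \<psi> y assume "y \<in> carrier B" and *: "\<forall>d\<in>carrier A. l y \<in> hom_class A F d \<longrightarrow> \<psi> (k d) = \<psi> y"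
    then have "l y \<in> carrier A"
      using l by auto
    moreover from this have "l y \<in> hom_class A F (l y)"
      by (simp add: hom_class_def)
    ultimately show "\<psi> (k (l y)) = \<psi> y"
      using * by blast
  qed
  have 3: "(\<forall>\<psi>\<in>hom H F. \<forall>y\<in>carrier H. \<psi> (f (h y)) = \<psi> y) \<longleftrightarrow> ?R3" if R1: ?R1
    by (rule section_iff[OF iffD2[OF hom_iff[OF f] R1] h])
  have 4: "(\<forall>\<phi>\<in>hom G F. \<forall>x\<in>carrier G. \<phi> (h (f x)) = \<phi> x) \<longleftrightarrow> ?R4" if R2: ?R2
    by (rule section_iff[OF iffD2[OF hom_iff[OF h] R2] f])
  show ?thesis
    unfolding inverse_modulo_homs_def hom_iff[OF f] hom_iff[OF h]
    by (intro conj_cong refl 3 4)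
qed

lemma inverse_modulo_homs_cong:
  assumes "group G" "group H"
    and inv: "inverse_modulo_homs G H F f h" and f: "f \<in> carrier G \<rightarrow> carrier H" and h: "h \<in> carrier H \<rightarrow> carrier G"
    and f': "\<And>x. x \<in> carrier G \<Longrightarrow> f' x = f x" and h': "\<And>y. y \<in> carrier H \<Longrightarrow> h' y = h y"
  shows "inverse_modulo_homs G H F f' h'"
proof -
  interpret G: group G by fact
  interpret H: group H by fact
  have maps': "f' \<in> carrier G \<rightarrow> carrier H" "h' \<in> carrier H \<rightarrow> carrier G"
    using f h f' h' by auto
  show ?thesis
    using inv unfolding inverse_modulo_homs_iff[OF assms(1,2) f h] inverse_modulo_homs_iff[OF assms(1,2) maps']
    by (simp add: f' h')
qed

text \<open>A homomorphism into \<open>F\<close> becomes one into \<open>P\<close> by composition with the injection \<open>i\<close>, and is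
  recovered by \<open>p\<close>. With a product of groups as \<open>P\<close>, one pair of maps serves all factors.\<close>

lemma inverse_modulo_homs_retract:
  assumes "group G" "group H"
    and inv: "inverse_modulo_homs G H P f h" and f: "f \<in> carrier G \<rightarrow> carrier H" and h: "h \<in> carrier H \<rightarrow> carrier G"
    and i: "i \<in> hom F P" and p: "p \<in> hom P F" and pi: "\<And>z. z \<in> carrier F \<Longrightarrow> p (i z) = z"
  shows "inverse_modulo_homs G H F f h"
proof -
  interpret G: group G by fact
  interpret H: group H by fact
  have lift: "i \<circ> \<psi> \<in> hom K P" if "\<psi> \<in> hom K F" for \<psi> and K :: "('x, 'y) monoid_scheme"
    using hom_compose[OF that i] .
  have descend: "\<psi> \<circ> k \<in> hom K F" if \<psi>: "\<psi> \<in> hom L F" and k: "k \<in> carrier K \<rightarrow> carrier L"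
      and comp: "(i \<circ> \<psi>) \<circ> k \<in> hom K P" and K: "group K"
    for \<psi> k and K :: "('x, 'y) monoid_scheme" and L :: "('z, 'w) monoid_scheme"
  proof -
    have eq: "(p \<circ> ((i \<circ> \<psi>) \<circ> k)) x = (\<psi> \<circ> k) x" if "x \<in> carrier K" for x
      using pi hom_in_carrier[OF \<psi>, of "k x"] k that by auto
    have "p \<circ> ((i \<circ> \<psi>) \<circ> k) \<in> hom K F"
      by (rule hom_compose[OF comp p])
    moreover have "x \<otimes>\<^bsub>K\<^esub> y \<in> carrier K" if "x \<in> carrier K" "y \<in> carrier K" for x y
      using K that by (simp add: group.is_monoid monoid.m_closed)
    ultimately show ?thesis
      using eq unfolding hom_def by (auto simp: Pi_iff)
  qed
  show ?thesis
    unfolding inverse_modulo_homs_def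
  proof (intro conjI ballI)
    fix \<psi> assume \<psi>: "\<psi> \<in> hom H F"
    show "\<psi> \<circ> f \<in> hom G F"
      using inv lift[OF \<psi>] by (intro descend[OF \<psi> f _ assms(1)]) (simp add: inverse_modulo_homs_def)
    fix y assume y: "y \<in> carrier H"
    then have "i (\<psi> (f (h y))) = i (\<psi> y)"
      using inv lift[OF \<psi>] unfolding inverse_modulo_homs_def by fastforce
    moreover have "\<psi> (f (h y)) \<in> carrier F" "\<psi> y \<in> carrier F"
      using hom_in_carrier[OF \<psi>] f h y by auto
    ultimately show "\<psi> (f (h y)) = \<psi> y"
      using pi by metis
  next
    fix \<phi> assume \<phi>: "\<phi> \<in> hom G F"
    show "\<phi> \<circ> h \<in> hom H F"
      using inv lift[OF \<phi>] by (intro descend[OF \<phi> h _ assms(2)]) (simp add: inverse_modulo_homs_def)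
    fix x assume x: "x \<in> carrier G"
    then have "i (\<phi> (h (f x))) = i (\<phi> x)"
      using inv lift[OF \<phi>] unfolding inverse_modulo_homs_def by fastforce
    moreover have "\<phi> (h (f x)) \<in> carrier F" "\<phi> x \<in> carrier F"
      using hom_in_carrier[OF \<phi>] f h x by auto
    ultimately show "\<phi> (h (f x)) = \<phi> x"
      using pi by metis
  qed
qed

lemma product_group_retract:
  assumes J: "F \<in> J" and groups: "\<And>K. K \<in> J \<Longrightarrow> group K"
  shows "\<exists>i p. i \<in> hom F (product_group J (\<lambda>K. K)) \<and> p \<in> hom (product_group J (\<lambda>K. K)) F \<and>
    (\<forall>z\<in>carrier F. p (i z) = z)"
proof -
  let ?i = "\<lambda>z. \<lambda>K\<in>J. if K = F then z else \<one>\<^bsub>K\<^esub>"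
  have "?i \<in> hom F (product_group J (\<lambda>K. K))"
  proof (rule homI)
    show "?i z \<in> carrier (product_group J (\<lambda>K. K))" if "z \<in> carrier F" for z
      using that groups by (auto simp: group.is_monoid monoid.one_closed)
    show "?i (x \<otimes>\<^bsub>F\<^esub> y) = ?i x \<otimes>\<^bsub>product_group J (\<lambda>K. K)\<^esub> ?i y" for x y
      using groups by (auto simp: fun_eq_iff restrict_def group.is_monoid monoid.l_one monoid.one_closed)
  qed
  moreover have "(\<lambda>v. v F) \<in> hom (product_group J (\<lambda>K. K)) F"
    using J by (intro homI) auto
  ultimately show ?thesis
    using J by (intro exI[of _ ?i] exI[of _ "\<lambda>v. v F"]) auto
qed

lemma closedin_ball:
  assumes "\<And>i. i \<in> I \<Longrightarrow> closedin X {x \<in> topspace X. P i x}"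
  shows "closedin X {x \<in> topspace X. \<forall>i\<in>I. P i x}"
proof -
  have eq: "{x \<in> topspace X. \<forall>i\<in>I. P i x} = \<Inter>(insert (topspace X) ((\<lambda>i. {x \<in> topspace X. P i x}) ` I))"
    by auto
  show ?thesis
    unfolding eq by (rule closedin_Inter) (use assms in auto)
qed

lemma closedin_conj:
  assumes "closedin X {x \<in> topspace X. P x}" "closedin X {x \<in> topspace X. Q x}"
  shows "closedin X {x \<in> topspace X. P x \<and> Q x}"
proof -
  have "{x \<in> topspace X. P x \<and> Q x} = {x \<in> topspace X. P x} \<inter> {x \<in> topspace X. Q x}"
    by auto
  then show ?thesis
    using closedin_Int[OF assms] by simp
qed

context compact_group
begin

lemma openin_fibre_of_hom_classes:
  assumes opn: "\<And>d. d \<in> carrier G \<Longrightarrow> openin T (hom_class G F d)" and \<phi>: "\<phi> \<in> hom G F"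
  shows "openin T {x \<in> carrier G. \<phi> x = c}"
proof -
  have "{x \<in> carrier G. \<phi> x = c} = (\<Union>d\<in>{x \<in> carrier G. \<phi> x = c}. hom_class G F d)"
    using \<phi> by (fastforce simp: hom_class_def)
  also have "openin T \<dots>"
    using opn by (intro openin_Union) auto
  finally show ?thesis .
qed

lemma closedin_equal_under_hom:
  assumes opn: "\<And>d. d \<in> carrier G \<Longrightarrow> openin T (hom_class G F d)" and \<phi>: "\<phi> \<in> hom G F"
    and u: "continuous_map X T u" and v: "continuous_map X T v"
  shows "closedin X {p \<in> topspace X. \<phi> (u p) = \<phi> (v p)}"
proof (rule closedin_continuous_maps_eq)
  have "continuous_map T (discrete_topology (carrier F)) \<phi>"
    unfolding continuous_map_def
  proof (intro conjI allI impI)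
    show "\<phi> \<in> topspace T \<rightarrow> topspace (discrete_topology (carrier F))"
      using hom_in_carrier[OF \<phi>] by auto
    show "openin T {x \<in> topspace T. \<phi> x \<in> U}" for U
      using openin_hom_preimage[OF openin_fibre_of_hom_classes[OF opn \<phi>], of U] by simp
  qed
  then show "continuous_map X (discrete_topology (carrier F)) (\<lambda>p. \<phi> (u p))"
      "continuous_map X (discrete_topology (carrier F)) (\<lambda>p. \<phi> (v p))"
    using continuous_map_compose[OF u] continuous_map_compose[OF v] by (auto simp: o_def)
qed simp

lemma closedin_preimage_hom_class_imp:
  assumes opn: "\<And>d. d \<in> carrier G \<Longrightarrow> openin T (hom_class G F d)" and d: "d \<in> carrier G"
    and u: "continuous_map X T u" and Q: "closedin X {p \<in> topspace X. Q p}"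
  shows "closedin X {p \<in> topspace X. u p \<in> hom_class G F d \<longrightarrow> Q p}"
proof -
  have "closedin T (topspace T - hom_class G F d)"
    using opn[OF d] by (intro closedin_diff closedin_topspace)
  from closedin_continuous_map_preimage[OF u this]
  have "closedin X ({p \<in> topspace X. u p \<in> topspace T - hom_class G F d} \<union> {p \<in> topspace X. Q p})"
    using Q by (rule closedin_Un)
  moreover have "u p \<in> topspace T" if "p \<in> topspace X" for p
    using continuous_map_image_subset_topspace[OF u] that by auto
  then have "{p \<in> topspace X. u p \<in> topspace T - hom_class G F d} \<union> {p \<in> topspace X. Q p} =
      {p \<in> topspace X. u p \<in> hom_class G F d \<longrightarrow> Q p}"
    by auto
  ultimately show ?thesis by simp
qed

end

text \<open>Tychonoff's theorem for the space of all pairs of maps. Its points are extensional functions,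
  so the maps given for a finite family are restricted to the carriers.\<close>

lemma glue_inverse_modulo_homs:
  fixes \<F> :: "('c, 'k) monoid_scheme set"
  assumes G: "compact_group G T" and H: "compact_group H S"
    and opnG: "\<And>F d. F \<in> \<F> \<Longrightarrow> d \<in> carrier G \<Longrightarrow> openin T (hom_class G F d)"
    and opnH: "\<And>F d. F \<in> \<F> \<Longrightarrow> d \<in> carrier H \<Longrightarrow> openin S (hom_class H F d)"
    and fin: "\<And>J. finite J \<Longrightarrow> J \<subseteq> \<F> \<Longrightarrow> \<exists>f h. f \<in> carrier G \<rightarrow> carrier H \<and> h \<in> carrier H \<rightarrow> carrier G \<and>
      (\<forall>F\<in>J. inverse_modulo_homs G H F f h)"
  shows "\<exists>f h. f \<in> carrier G \<rightarrow> carrier H \<and> h \<in> carrier H \<rightarrow> carrier G \<and> (\<forall>F\<in>\<F>. inverse_modulo_homs G H F f h)"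
proof -
  interpret G: compact_group G T by fact
  interpret H: compact_group H S by fact
  define X where "X = prod_topology (product_topology (\<lambda>_. S) (carrier G)) (product_topology (\<lambda>_. T) (carrier H))"
  have X: "p \<in> topspace X \<longleftrightarrow> fst p \<in> carrier G \<rightarrow>\<^sub>E carrier H \<and> snd p \<in> carrier H \<rightarrow>\<^sub>E carrier G" for p
    by (cases p) (simp add: X_def)
  have maps: "fst p \<in> carrier G \<rightarrow> carrier H" "snd p \<in> carrier H \<rightarrow> carrier G" if "p \<in> topspace X" for p
    using that by (auto simp: X)
  have cf: "continuous_map X S (\<lambda>p. fst p a)" if "a \<in> carrier G" for a
    using continuous_map_compose[OF continuous_map_fst continuous_map_product_projection[OF that, of "\<lambda>_. S"]]
    by (simp add: X_def o_def)
  have ch: "continuous_map X T (\<lambda>p. snd p b)" if "b \<in> carrier H" for b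
    using continuous_map_compose[OF continuous_map_snd continuous_map_product_projection[OF that, of "\<lambda>_. T"]]
    by (simp add: X_def o_def)
  have "compact_space X"
    using G.compact H.compact by (simp add: X_def compact_space_prod_topology compact_space_product_topology)
  then have "\<exists>p\<in>topspace X. \<forall>F\<in>\<F>. p \<in> {p \<in> topspace X. inverse_modulo_homs G H F (fst p) (snd p)}"
  proof (rule compact_space_fip_family)
    fix F assume F: "F \<in> \<F>"
    let ?Q = "\<lambda>p. (\<forall>\<psi>\<in>hom H F. \<forall>a\<in>carrier G. \<forall>b\<in>carrier G. \<psi> (fst p (a \<otimes>\<^bsub>G\<^esub> b)) = \<psi> (fst p a \<otimes>\<^bsub>H\<^esub> fst p b)) \<and>
      (\<forall>\<phi>\<in>hom G F. \<forall>a\<in>carrier H. \<forall>b\<in>carrier H. \<phi> (snd p (a \<otimes>\<^bsub>H\<^esub> b)) = \<phi> (snd p a \<otimes>\<^bsub>G\<^esub> snd p b)) \<and>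
      (\<forall>\<psi>\<in>hom H F. \<forall>y\<in>carrier H. \<forall>d\<in>carrier G. snd p y \<in> hom_class G F d \<longrightarrow> \<psi> (fst p d) = \<psi> y) \<and>
      (\<forall>\<phi>\<in>hom G F. \<forall>x\<in>carrier G. \<forall>d\<in>carrier H. fst p x \<in> hom_class H F d \<longrightarrow> \<phi> (snd p d) = \<phi> x)"
    have "closedin X {p \<in> topspace X. ?Q p}"
      by (intro closedin_conj closedin_ball G.closedin_preimage_hom_class_imp H.closedin_preimage_hom_class_imp
          G.closedin_equal_under_hom H.closedin_equal_under_hom G.continuous_map_mult H.continuous_map_mult
          opnG[OF F] opnH[OF F] cf ch G.m_closed H.m_closed) (simp_all add: opnG[OF F] opnH[OF F])
    moreover have "{p \<in> topspace X. ?Q p} = {p \<in> topspace X. inverse_modulo_homs G H F (fst p) (snd p)}"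
      by (intro Collect_cong conj_cong refl inverse_modulo_homs_iff[OF G.is_group H.is_group maps, symmetric])
    ultimately show "closedin X {p \<in> topspace X. inverse_modulo_homs G H F (fst p) (snd p)}"
      by simp
  next
    fix J assume "finite J" "J \<subseteq> \<F>"
    then obtain f h where f: "f \<in> carrier G \<rightarrow> carrier H" and h: "h \<in> carrier H \<rightarrow> carrier G"
      and J: "\<And>F. F \<in> J \<Longrightarrow> inverse_modulo_homs G H F f h"
      using fin[of J] by (elim meta_impE exE conjE) auto
    let ?p = "(restrict f (carrier G), restrict h (carrier H))"
    have "inverse_modulo_homs G H F (fst ?p) (snd ?p)" if "F \<in> J" for F
      by (rule inverse_modulo_homs_cong[OF G.is_group H.is_group J[OF that] f h]) simp_all
    moreover have "?p \<in> topspace X"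
      using f h by (auto simp: X)
    ultimately show "\<exists>p\<in>topspace X. \<forall>F\<in>J. p \<in> {p \<in> topspace X. inverse_modulo_homs G H F (fst p) (snd p)}"
      by (intro bexI[of _ ?p]) auto
  qed
  then obtain p where p: "p \<in> topspace X" "\<And>F. F \<in> \<F> \<Longrightarrow> inverse_modulo_homs G H F (fst p) (snd p)"
    by auto
  then show ?thesis
    using maps[OF p(1)] by (intro exI[of _ "fst p"] exI[of _ "snd p"]) simp
qed

definition determines_topology where
  "determines_topology \<F> G T \<longleftrightarrow>
     (\<forall>U x. openin T U \<longrightarrow> x \<in> U \<longrightarrow> (\<exists>F\<in>\<F>. \<exists>\<phi>\<in>hom G F. \<forall>y\<in>carrier G. \<phi> y = \<phi> x \<longrightarrow> y \<in> U))"

lemma (in compact_group) determines_topology_separates: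
  assumes det: "determines_topology \<F> G T" and x: "x \<in> carrier G" and y: "y \<in> carrier G"
    and eq: "\<And>F \<phi>. F \<in> \<F> \<Longrightarrow> \<phi> \<in> hom G F \<Longrightarrow> \<phi> y = \<phi> x"
  shows "y = x"
proof (rule ccontr)
  assume "y \<noteq> x"
  have "openin T (topspace T - {y})"
    using Hausdorff y by (intro openin_diff openin_topspace) (simp add: closedin_Hausdorff_sing_eq)
  moreover have "x \<in> topspace T - {y}"
    using x \<open>y \<noteq> x\<close> by simp
  ultimately obtain F \<phi> where "F \<in> \<F>" "\<phi> \<in> hom G F" "\<phi> y = \<phi> x \<longrightarrow> y \<in> topspace T - {y}"
    using det y unfolding determines_topology_def by meson
  then show False
    using eq by auto
qed

text \<open>Each property of \<open>f\<close> and \<open>h\<close> holds after composition with every homomorphism into a member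
  of \<open>\<F>\<close>, hence holds outright, because these homomorphisms separate points. Continuity of \<open>f\<close>
  follows likewise, as \<open>\<psi> \<circ> f\<close> is a homomorphism and hence has open fibres.\<close>

lemma profinite_isomorphic_of_inverse_modulo_homs:
  assumes G: "compact_group G T" and H: "compact_group H S"
    and opnG: "\<And>F d. F \<in> \<F> \<Longrightarrow> d \<in> carrier G \<Longrightarrow> openin T (hom_class G F d)"
    and detG: "determines_topology \<F> G T" and detH: "determines_topology \<F> H S"
    and f: "f \<in> carrier G \<rightarrow> carrier H" and h: "h \<in> carrier H \<rightarrow> carrier G"
    and inv: "\<And>F. F \<in> \<F> \<Longrightarrow> inverse_modulo_homs G H F f h"
  shows "profinite_isomorphic G T H S"
proof -
  interpret G: compact_group G T by fact
  interpret H: compact_group H S by fact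
  have fc: "f x \<in> carrier H" if "x \<in> carrier G" for x
    using f that by auto
  have hc: "h y \<in> carrier G" if "y \<in> carrier H" for y
    using h that by auto
  have comp: "\<psi> \<circ> f \<in> hom G F" if "F \<in> \<F>" "\<psi> \<in> hom H F" for F \<psi>
    using inv[OF that(1)] that(2) by (simp add: inverse_modulo_homs_def)
  have "f (a \<otimes>\<^bsub>G\<^esub> b) = f a \<otimes>\<^bsub>H\<^esub> f b" if ab: "a \<in> carrier G" "b \<in> carrier G" for a b
  proof (rule H.determines_topology_separates[OF detH])
    fix F \<psi> assume F: "F \<in> \<F>" "\<psi> \<in> hom H F"
    show "\<psi> (f (a \<otimes>\<^bsub>G\<^esub> b)) = \<psi> (f a \<otimes>\<^bsub>H\<^esub> f b)"
      using hom_mult[OF comp[OF F] ab] hom_mult[OF F(2) fc[OF ab(1)] fc[OF ab(2)]] by simp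
  qed (use ab fc in auto)
  then have hom: "f \<in> hom G H"
    using fc by (intro homI)
  have hf: "h (f x) = x" if "x \<in> carrier G" for x
    by (rule G.determines_topology_separates[OF detG that hc[OF fc[OF that]]])
      (use inv that in \<open>simp add: inverse_modulo_homs_def\<close>)
  have fh: "f (h y) = y" if "y \<in> carrier H" for y
    by (rule H.determines_topology_separates[OF detH that fc[OF hc[OF that]]])
      (use inv that in \<open>simp add: inverse_modulo_homs_def\<close>)
  have inj: "inj_on f (carrier G)"
    using hf by (rule inj_on_inverseI)
  have img: "f ` carrier G = carrier H"
  proof
    show "carrier H \<subseteq> f ` carrier G"
      using fh hc by (metis image_eqI subsetI)
  qed (use fc in auto)
  have "continuous_map T S f"
    unfolding continuous_map_def
  proof (intro conjI allI impI)
    show "f \<in> topspace T \<rightarrow> topspace S"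
      using fc by auto
    fix U assume U: "openin S U"
    show "openin T {x \<in> topspace T. f x \<in> U}"
    proof (subst openin_subopen, intro ballI)
      fix x assume x: "x \<in> {x \<in> topspace T. f x \<in> U}"
      then have "f x \<in> U" by simp
      from detH[unfolded determines_topology_def, rule_format, OF U this]
      obtain F \<psi> where F: "F \<in> \<F>" "\<psi> \<in> hom H F" "\<And>y. y \<in> carrier H \<Longrightarrow> \<psi> y = \<psi> (f x) \<Longrightarrow> y \<in> U"
        by (elim bexE) blast
      let ?V = "{z \<in> carrier G. (\<psi> \<circ> f) z = \<psi> (f x)}"
      have "openin T ?V"
        by (rule G.openin_fibre_of_hom_classes[OF opnG[OF F(1)] comp[OF F(1,2)]])
      moreover have "x \<in> ?V" "?V \<subseteq> {x \<in> topspace T. f x \<in> U}"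
        using x F(3) fc by auto
      ultimately show "\<exists>V. openin T V \<and> x \<in> V \<and> V \<subseteq> {x \<in> topspace T. f x \<in> U}"
        by (intro exI[of _ ?V] conjI)
    qed
  qed
  then have "homeomorphic_map T S f"
    using G.compact H.Hausdorff inj img by (intro continuous_imp_homeomorphic_map) simp_all
  moreover have "f \<in> iso G H"
    using hom inj img by (simp add: iso_def bij_betw_def)
  ultimately show ?thesis
    unfolding profinite_isomorphic_def by blast
qed

lemma open_normal_subgroup_coset_inside:
  assumes G: "profinite_group G T" and U: "openin T U" "x \<in> U"
  shows "\<exists>N. N \<lhd> G \<and> openin T N \<and> (\<forall>y\<in>carrier G. N #>\<^bsub>G\<^esub> y = N #>\<^bsub>G\<^esub> x \<longrightarrow> y \<in> U)"
proof -
  interpret compact_group G T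
    using profinite_groupD[OF G] .
  have x: "x \<in> carrier G"
    using openin_subset[OF U(1)] U(2) by auto
  obtain V where V: "openin T V" "closedin T V" "x \<in> V" "V \<subseteq> U"
    using profinite_clopen_base[OF G U] by blast
  let ?W = "{z \<in> topspace T. z \<otimes>\<^bsub>G\<^esub> x \<in> V}"
  have c: "continuous_map T T (\<lambda>z. z \<otimes>\<^bsub>G\<^esub> x)"
    using continuous_map_mult[of T "\<lambda>z. z" "\<lambda>_. x"] x by simp
  have "openin T ?W" "closedin T ?W" "\<one>\<^bsub>G\<^esub> \<in> ?W"
    using openin_continuous_map_preimage[OF c V(1)] closedin_continuous_map_preimage[OF c V(2)] V(3) x by auto
  then obtain N where N: "N \<lhd> G" "openin T N" "N \<subseteq> ?W"
    using open_normal_inside_clopen by blast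
  have "y \<in> U" if y: "y \<in> carrier G" "N #>\<^bsub>G\<^esub> y = N #>\<^bsub>G\<^esub> x" for y
  proof -
    have "y \<in> N #>\<^bsub>G\<^esub> x"
      using rcos_self[OF y(1) normal_imp_subgroup[OF N(1)]] y(2) by simp
    then obtain n where "n \<in> N" "y = n \<otimes>\<^bsub>G\<^esub> x"
      by (auto simp: r_coset_def)
    then show ?thesis
      using N(3) V(4) by auto
  qed
  then show ?thesis
    using N by blast
qed

text \<open>A single type of finite groups must serve both \<open>G\<close> and \<open>H\<close>. Products of a finite quotient of
  \<open>G\<close> with a finite quotient of \<open>H\<close> achieve this, since each factor embeds in the product.\<close>

definition finite_quotient_pairs where
  "finite_quotient_pairs G T H S =
     {(G Mod N) \<times>\<times> (H Mod M) | N M. N \<lhd> G \<and> openin T N \<and> M \<lhd> H \<and> openin S M}"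

lemma finite_quotient_pairs:
  assumes G: "profinite_group G T" and H: "profinite_group H S"
  shows "F \<in> finite_quotient_pairs G T H S \<Longrightarrow> group F \<and> finite (carrier F)"
    and "determines_topology (finite_quotient_pairs G T H S) G T"
    and "determines_topology (finite_quotient_pairs G T H S) H S"
proof -
  interpret G: compact_group G T using profinite_groupD[OF G] .
  interpret H: compact_group H S using profinite_groupD[OF H] .
  have topG: "\<exists>N. N \<lhd> G \<and> openin T N"
    using G.open_normal_inside_clopen[OF openin_topspace closedin_topspace] by auto
  have topH: "\<exists>M. M \<lhd> H \<and> openin S M"
    using H.open_normal_inside_clopen[OF openin_topspace closedin_topspace] by auto
  show "group F \<and> finite (carrier F)" if F: "F \<in> finite_quotient_pairs G T H S"
  proof -
    obtain N M where NM: "F = (G Mod N) \<times>\<times> (H Mod M)" "N \<lhd> G" "openin T N" "M \<lhd> H" "openin S M"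
      using F by (auto simp: finite_quotient_pairs_def)
    have "finite (carrier (G Mod N))" "finite (carrier (H Mod M))"
      using G.finite_rcosets_open_subgroup[OF normal_imp_subgroup] H.finite_rcosets_open_subgroup[OF normal_imp_subgroup] NM
      by (auto simp: FactGroup_def)
    then show ?thesis
      using NM by (simp add: DirProd_group normal.factorgroup_is_group)
  qed
  show "determines_topology (finite_quotient_pairs G T H S) G T"
    unfolding determines_topology_def
  proof (intro allI impI)
    fix U x assume "openin T U" "x \<in> U"
    then obtain N where N: "N \<lhd> G" "openin T N" "\<And>y. y \<in> carrier G \<Longrightarrow> N #>\<^bsub>G\<^esub> y = N #>\<^bsub>G\<^esub> x \<Longrightarrow> y \<in> U"
      using open_normal_subgroup_coset_inside[OF G] by meson
    obtain M where M: "M \<lhd> H" "openin S M"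
      using topH by blast
    interpret M: group "H Mod M"
      using M by (rule_tac normal.factorgroup_is_group)
    let ?F = "(G Mod N) \<times>\<times> (H Mod M)" and ?\<phi> = "\<lambda>y. (N #>\<^bsub>G\<^esub> y, \<one>\<^bsub>H Mod M\<^esub>)"
    have "?F \<in> finite_quotient_pairs G T H S"
      using N M unfolding finite_quotient_pairs_def by blast
    moreover have "?\<phi> \<in> hom G ?F"
      using normal.r_coset_hom_Mod[OF N(1)] M.one_closed M.l_one
      unfolding hom_def by (auto simp: Pi_iff simp del: one_FactGroup)
    ultimately show "\<exists>F\<in>finite_quotient_pairs G T H S. \<exists>\<phi>\<in>hom G F. \<forall>y\<in>carrier G. \<phi> y = \<phi> x \<longrightarrow> y \<in> U"
      using N(3) by (intro bexI[of _ ?F] bexI[of _ ?\<phi>]) auto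
  qed
  show "determines_topology (finite_quotient_pairs G T H S) H S"
    unfolding determines_topology_def
  proof (intro allI impI)
    fix U x assume "openin S U" "x \<in> U"
    then obtain M where M: "M \<lhd> H" "openin S M" "\<And>y. y \<in> carrier H \<Longrightarrow> M #>\<^bsub>H\<^esub> y = M #>\<^bsub>H\<^esub> x \<Longrightarrow> y \<in> U"
      using open_normal_subgroup_coset_inside[OF H] by meson
    obtain N where N: "N \<lhd> G" "openin T N"
      using topG by blast
    interpret N: group "G Mod N"
      using N by (rule_tac normal.factorgroup_is_group)
    let ?F = "(G Mod N) \<times>\<times> (H Mod M)" and ?\<phi> = "\<lambda>y. (\<one>\<^bsub>G Mod N\<^esub>, M #>\<^bsub>H\<^esub> y)"
    have "?F \<in> finite_quotient_pairs G T H S"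
      using N M unfolding finite_quotient_pairs_def by blast
    moreover have "?\<phi> \<in> hom H ?F"
      using normal.r_coset_hom_Mod[OF M(1)] N.one_closed N.l_one
      unfolding hom_def by (auto simp: Pi_iff simp del: one_FactGroup)
    ultimately show "\<exists>F\<in>finite_quotient_pairs G T H S. \<exists>\<phi>\<in>hom H F. \<forall>y\<in>carrier H. \<phi> y = \<phi> x \<longrightarrow> y \<in> U"
      using M(3) by (intro bexI[of _ ?F] bexI[of _ ?\<phi>]) auto
  qed
qed

lemma openin_hom_class_strongly_complete:
  assumes G: "compact_group G T" and sc: "strongly_complete G T"
    and F: "group F" "finite (carrier F)" and d: "d \<in> carrier G"
  shows "openin T (hom_class G F d)"
proof -
  interpret G: compact_group G T by fact
  show ?thesis
    using G.openin_hom_class[OF F G.strongly_complete_openin_fibre[OF sc F] d] .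
qed

text \<open>Both directions are stated because the construction is symmetric in the pair \<open>(f, h)\<close>; this
  covers the case in which the second group is the strongly complete one.\<close>

lemma strongly_complete_elementarily_equivalent_isomorphic:
  assumes G: "profinite_group G T" and H: "profinite_group H S"
    and eq: "elementarily_equivalent G H" and sc: "strongly_complete G T"
  shows "profinite_isomorphic G T H S" and "profinite_isomorphic H S G T"
proof -
  interpret G: compact_group G T using profinite_groupD[OF G] .
  interpret H: compact_group H S using profinite_groupD[OF H] .
  let ?\<F> = "finite_quotient_pairs G T H S"
  note fin = finite_quotient_pairs(1)[OF G H]
  note opnG = openin_hom_class_strongly_complete[OF G.compact_group_axioms sc]
  note opnH = elementarily_equivalent_finite_quotients(1)[OF G.compact_group_axioms H.compact_group_axioms eq]
  have "\<exists>f h. f \<in> carrier G \<rightarrow> carrier H \<and> h \<in> carrier H \<rightarrow> carrier G \<and> (\<forall>F\<in>?\<F>. inverse_modulo_homs G H F f h)"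
  proof (rule glue_inverse_modulo_homs[OF G.compact_group_axioms H.compact_group_axioms])
    fix J assume J: "finite J" "J \<subseteq> ?\<F>"
    let ?P = "product_group J (\<lambda>K. K)"
    have groups: "group K" "finite (carrier K)" if "K \<in> J" for K
      using fin J(2) that by blast+
    have P: "group ?P" "finite (carrier ?P)"
      using groups J(1) by (auto intro: finite_PiE)
    obtain f h where f: "f \<in> carrier G \<rightarrow> carrier H" and h: "h \<in> carrier H \<rightarrow> carrier G"
      and inv: "inverse_modulo_homs G H ?P f h"
      using elementarily_equivalent_finite_quotients(2)[OF G.compact_group_axioms H.compact_group_axioms eq P opnG[OF P]]
      by blast
    have "inverse_modulo_homs G H F f h" if F: "F \<in> J" for F
      using product_group_retract[OF F groups(1)] inverse_modulo_homs_retract[OF G.is_group H.is_group inv f h]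
      by blast
    then show "\<exists>f h. f \<in> carrier G \<rightarrow> carrier H \<and> h \<in> carrier H \<rightarrow> carrier G \<and> (\<forall>F\<in>J. inverse_modulo_homs G H F f h)"
      using f h by blast
  qed (use fin opnG opnH[OF _ _ opnG] in blast)+
  then obtain f h where f: "f \<in> carrier G \<rightarrow> carrier H" and h: "h \<in> carrier H \<rightarrow> carrier G"
    and inv: "\<And>F. F \<in> ?\<F> \<Longrightarrow> inverse_modulo_homs G H F f h"
    by blast
  show "profinite_isomorphic G T H S"
    by (rule profinite_isomorphic_of_inverse_modulo_homs[OF G.compact_group_axioms H.compact_group_axioms _
          finite_quotient_pairs(2,3)[OF G H] f h inv]) (use fin opnG in blast)+
  show "profinite_isomorphic H S G T"
    by (rule profinite_isomorphic_of_inverse_modulo_homs[OF H.compact_group_axioms G.compact_group_axioms _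
          finite_quotient_pairs(3,2)[OF G H] h f inverse_modulo_homs_sym[OF inv]]) (use fin opnH[OF _ _ opnG] in blast)+
qed

theorem theorem1p5:
  fixes G :: "('a, 'm) monoid_scheme" and T :: "'a topology"
    and H :: "('b, 'n) monoid_scheme" and S :: "'b topology"
  assumes "profinite_group G T"
    and "profinite_group H S"
    and "elementarily_equivalent G H"
    and "strongly_complete G T \<or> strongly_complete H S"
  shows "profinite_isomorphic G T H S"
proof -
  have "elementarily_equivalent H G"
    using assms(3) by (simp add: elementarily_equivalent_def)
  then show ?thesis
    using strongly_complete_elementarily_equivalent_isomorphic assms by blast
qed

end
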